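(* Let $N\ge 2$ and $j\ge 2$ be integers, let $u=(1/N,\dots,1/N)$, let $p=(p_1,\dots,p_N)$ be a probability vector with all $p_i>0$ and $p\ne u$, and let $p(\theta)=u+\theta(p-u)$ for $0\le\theta\le1$. If $0\le\theta_1<\theta_2\le 1$, then $$U_{j,p(\theta_2)}^N\le_{\rm abm}U_{j,p(\theta_1)}^N.$$ Equivalently, for every function $f:\{0,1,\dots,N\}\to\mathbb R$ of the form $$f(k)=\sum_{m=0}^N a_m\binom{k}{m},\qquad a_m\in\mathbb R,\quad a_m\ge 0\ \text{ for } m\ge1,$$ one has $$\mathbb E_{p(\theta_2)}f(U_j^N)\le \mathbb E_{p(\theta_1)}f(U_j^N).$$ The inequality is strict whenever at least one coefficient $a_m$ with $m\ge 1$ is positive.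
   Context: Siblings coupon-collector model: for a probability vector $p=(p_1,\dots,p_N)$ with all $p_i>0$, coupons with types in $\{1,\dots,N\}$ are sampled independently with replacement, each having type $i$ with probability $p_i$. The main collector stops at the first time $\tau$ at which all $N$ types have appeared at least once (almost surely finite). Duplicates are passed to the next collector (sibling); if that collector already has that type, the coupon is passed to the next sibling, and so on. $U_j^N$ is the number of empty spaces in the $j$th collector's album at time $\tau$ (the main collector being the first collector); equivalently, $U_j^N$ is the number of coupon types whose total count among the first $\tau$ coupons is less than $j$. $\mathbb E_p$ denotes expectation when the coupon-type law is $p$, and $U_{j,p}^N$ denotes the random variable $U_j^N$ when the coupon-type law is $p$. Finite absolutely-monotone order: for random variables $X,Y$ supported on $\{0,1,\dots,N\}$, $X\le_{\rm abm}Y$ means that $\mathbb E f(X)\le\mathbb E f(Y)$ for every $f:\{0,1,\dots,N\}\to\mathbb R$ with binomial-basis expansion $f(k)=\sum_{m=0}^N a_m\binom{k}{m}$ with $a_m\ge0$ for all $m\ge1$ ($a_0$ an arbitrary real); equivalently, $\mathbb E\binom{X}{m}\le\mathbb E\binom{Y}{m}$ for $1\le m\le N$. *)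

theory Defs
  imports "HOL-Probability.Probability"
begin

text \<open>Coupon types are \<open>1, \<dots>, N\<close>, and only the values of a law \<open>p\<close> on \<open>{1..N}\<close> matter.
  A sample point is the sequence \<open>\<omega>\<close> of drawn types; \<open>\<omega> t\<close> is the coupon drawn at time \<open>t + 1\<close>, so
  the first \<open>t\<close> coupons are \<open>\<omega> 0, \<dots>, \<omega> (t - 1)\<close>.\<close>

definition coupon_space :: "nat \<Rightarrow> (nat \<Rightarrow> real) \<Rightarrow> (nat \<Rightarrow> nat) measure" where
  "coupon_space N p =
     (\<Pi>\<^sub>M t\<in>(UNIV :: nat set). point_measure {1..N} (\<lambda>i. ennreal (p i)))"

text \<open>The time at which the collection is first complete.  The set of \<open>\<omega>\<close> for which it never is (where
  \<open>LEAST\<close> is a meaningless constant) is a null set when all \<open>p i\<close> are positive.\<close>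

definition completion_time :: "nat \<Rightarrow> (nat \<Rightarrow> nat) \<Rightarrow> nat" where
  "completion_time N \<omega> = (LEAST t. \<forall>i\<in>{1..N}. \<exists>s<t. \<omega> s = i)"

text \<open>\<open>album \<omega> t r\<close> is the set of types in the album of collector \<open>r\<close> after \<open>t\<close> coupons.  The main
  collector is \<open>r = 1\<close>, and the index \<open>0\<close> is unused.  A coupon is handed down the line to the first
  collector who does not yet own its type.\<close>

primrec album :: "(nat \<Rightarrow> nat) \<Rightarrow> nat \<Rightarrow> nat \<Rightarrow> nat set" where
  "album \<omega> 0 = (\<lambda>r. {})"
| "album \<omega> (Suc t) =
     (let r = (LEAST r. 1 \<le> r \<and> \<omega> t \<notin> album \<omega> t r)
      in (album \<omega> t)(r := insert (\<omega> t) (album \<omega> t r)))"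

definition empty_spaces :: "nat \<Rightarrow> nat \<Rightarrow> (nat \<Rightarrow> nat) \<Rightarrow> nat" where
  "empty_spaces N j \<omega> = card ({1..N} - album \<omega> (completion_time N \<omega>) j)"

lemma mem_album_iff:
  assumes "1 \<le> r"
  shows "i \<in> album \<omega> t r \<longleftrightarrow> r \<le> card {s. s < t \<and> \<omega> s = i}"
  using assms
proof (induction t arbitrary: r i)
  case 0
  then show ?case by simp
next
  case (Suc t)
  let ?c = "\<lambda>t i. card {s. s < t \<and> \<omega> s = i}"
  have least: "(LEAST r. 1 \<le> r \<and> \<omega> t \<notin> album \<omega> t r) = Suc (?c t (\<omega> t))"
  proof (rule Least_equality)
    show "1 \<le> Suc (?c t (\<omega> t)) \<and> \<omega> t \<notin> album \<omega> t (Suc (?c t (\<omega> t)))"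
      by (simp add: Suc.IH)
  next
    fix y
    assume y: "1 \<le> y \<and> \<omega> t \<notin> album \<omega> t y"
    then have "\<not> y \<le> ?c t (\<omega> t)"
      using Suc.IH by blast
    then show "Suc (?c t (\<omega> t)) \<le> y"
      by simp
  qed
  have "{s. s < Suc t \<and> \<omega> s = i} =
      (if \<omega> t = i then insert t {s. s < t \<and> \<omega> s = i} else {s. s < t \<and> \<omega> s = i})"
    by (simp add: set_eq_iff less_Suc_eq) blast
  then have "?c (Suc t) i = (if \<omega> t = i then Suc (?c t i) else ?c t i)"
    by simp
  moreover have "i \<in> album \<omega> (Suc t) r \<longleftrightarrow>
      i \<in> album \<omega> t r \<or> (i = \<omega> t \<and> r = Suc (?c t (\<omega> t)))"
    unfolding album.simps(2) Let_def least by auto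
  ultimately show ?case
    unfolding Suc.IH[OF Suc.prems] by auto
qed

lemma empty_spaces_eq:
  assumes "1 \<le> j"
  shows "empty_spaces N j \<omega> =
    card {i \<in> {1..N}. card {s. s < completion_time N \<omega> \<and> \<omega> s = i} < j}"
  unfolding empty_spaces_def
  by (rule arg_cong[where f = card]) (auto simp: mem_album_iff[OF assms] not_le)

definition uniform_law :: "nat \<Rightarrow> nat \<Rightarrow> real" where
  "uniform_law N i = 1 / real N"

definition segment_law :: "nat \<Rightarrow> (nat \<Rightarrow> real) \<Rightarrow> real \<Rightarrow> nat \<Rightarrow> real" where
  "segment_law N p \<theta> i = uniform_law N i + \<theta> * (p i - uniform_law N i)"

text \<open>\<open>f\<close> has coefficients \<open>a\<close> in the binomial basis of the functions on \<open>{0..N}\<close>, nonnegative except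
  possibly for \<open>a 0\<close>.\<close>

definition abm_expansion :: "nat \<Rightarrow> (nat \<Rightarrow> real) \<Rightarrow> (nat \<Rightarrow> real) \<Rightarrow> bool" where
  "abm_expansion N a f \<longleftrightarrow>
     (\<forall>m\<in>{1..N}. 0 \<le> a m) \<and> (\<forall>k\<in>{0..N}. f k = (\<Sum>m=0..N. a m * real (k choose m)))"

text \<open>The finite absolutely monotone order relates random variables on possibly different probability
  spaces.  Its domain, the random variables with values in \<open>{0..N}\<close>, is part of the definition, since
  the integral of a non-measurable function is \<open>0\<close> by convention.\<close>

definition abm_le ::
    "nat \<Rightarrow> 'a measure \<Rightarrow> ('a \<Rightarrow> nat) \<Rightarrow> 'b measure \<Rightarrow> ('b \<Rightarrow> nat) \<Rightarrow> bool" where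
  "abm_le N M X M' Y \<longleftrightarrow>
     prob_space M \<and> X \<in> M \<rightarrow>\<^sub>M count_space {0..N} \<and>
     prob_space M' \<and> Y \<in> M' \<rightarrow>\<^sub>M count_space {0..N} \<and>
     (\<forall>f a. abm_expansion N a f \<longrightarrow>
        (\<integral>\<omega>. f (X \<omega>) \<partial>M) \<le> (\<integral>\<omega>. f (Y \<omega>) \<partial>M'))"

end

theory Submission
  imports Defs "HOL-Real_Asymp.Real_Asymp"
begin

text \<open>By linearity everything reduces to the binomial moments of the number \<open>U\<close> of empty spaces, the
  expectations of \<open>binom(U, m)\<close> for \<open>1 \<le> m \<le> N\<close>: each of them has to decrease strictly along the segment.  The type
  that completes the collection has count \<open>1 < j\<close> at that time, so almost surely \<open>U \<ge> 1\<close>, and by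
  Pascal's rule it suffices to study the expectations \<open>k m\<close> of \<open>binom(U - 1, m)\<close>.  They are the
  coefficients of the generating function \<open>\<Sum>m. k m z ^ m\<close>, the expectation of \<open>(1 + z) ^ (U - 1)\<close>.

  Let the coupons arrive at the times of a Poisson process of rate \<open>1\<close>.  The types then become
  independent, and splitting according to the type \<open>i\<close> that arrives last and its arrival time \<open>t\<close> gives
  \<open>\<Sum>m. k m z ^ m = \<integral> K(t) dt\<close>, the integral being over \<open>t \<ge> 0\<close>, where
  \<open>K(t) = \<Sum>i. q i exp(- q i t) \<Prod>l\<noteq>i. W(q l t)\<close> and
  \<open>W(x) = 1 - exp(- x) + z exp(- x) \<Sum>1\<le>c<j. x ^ c / c!\<close>.  No Poisson process is constructed for
  this.  The expectation over words of length \<open>n\<close> is \<open>n!\<close> times a coefficient of a product of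
  exponential generating functions (\<open>nn_integral_words\<close>), and \<open>n! = \<integral> t ^ n exp(- t) dt\<close> turns the sum
  over \<open>n\<close> into the integral (\<open>suminf_words_eq_nn_integral\<close>).

  The monotonicity rests on one identity.  Write the law as \<open>q i = u + \<theta> d i\<close>, with \<open>u\<close> independent
  of \<open>i\<close>, and put \<open>E x = exp(- x)\<close>, \<open>g x = exp(- x) x ^ (j - 1) / (j - 1)!\<close>, \<open>x i = q i t\<close>.  Differentiating
  \<open>K\<close> in \<open>\<theta>\<close>, and \<open>B = t \<Sum>i. d i E(x i) \<Prod>l\<noteq>i. W(x l)\<close> in \<open>t\<close>, gives sums over the same products; they
  differ only by the weights \<open>q i d l - d i q l = u (d l - d i)\<close> in front of
  \<open>E(x i) W'(x l) \<Prod>k\<noteq>i,l. W(x k)\<close>.  These weights are antisymmetric in \<open>i\<close> and \<open>l\<close>.  Since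
  \<open>W' = (1 + z) E - z g\<close>, the part \<open>(1 + z) E(x i) E(x l)\<close> cancels on symmetrizing, and what is left
  is \<open>- z\<close> times a polynomial \<open>gap\<close> made of terms
  \<open>(d l - d i) (E(x i) g(x l) - E(x l) g(x i)) \<Prod>k\<noteq>i,l. W(x k)\<close> with positive factors in front.  Here
  \<open>E(x i) g(x l) - E(x l) g(x i)\<close> has the sign of \<open>q l - q i = \<theta> (d l - d i)\<close>, so all coefficients
  of \<open>gap\<close> are nonnegative (lemmas \<open>K'_eq\<close> and \<open>gap_nonneg\<close>).

  As \<open>B\<close> vanishes at \<open>t = 0\<close> and as \<open>t\<close> tends to infinity, integration over \<open>t\<close> shows that \<open>k m\<close>
  decreases in \<open>\<theta>\<close>, strictly for \<open>1 \<le> m < N\<close> and \<open>\<theta> > 0\<close> because the \<open>d i\<close> are not all equal and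
  the products in \<open>gap\<close> have positive coefficients up to degree \<open>N - 2\<close>.  To stay with compact domains, the integral is truncated at a time
  \<open>T\<close> that tends to infinity only after the mean value theorem in \<open>\<theta>\<close> has been applied
  (\<open>limit_decrease\<close>).  Finally the expectation of \<open>binom(U, m)\<close> is \<open>k m + k (m - 1)\<close>, and as \<open>N \<ge> 2\<close>
  at least one of the indices \<open>m\<close> and \<open>m - 1\<close> lies between \<open>1\<close> and \<open>N - 1\<close>.\<close>

section \<open>Curves of real polynomials\<close>

text \<open>Polynomials in the formal variable \<open>z\<close> carry no topology here, so derivatives and continuity of
  polynomial-valued maps are meant coefficient by coefficient.  Working with polynomials instead of
  their values at a fixed \<open>z\<close> is what yields inequalities for every single coefficient.\<close>

definition has_coeff_deriv :: "(real \<Rightarrow> real poly) \<Rightarrow> real poly \<Rightarrow> real \<Rightarrow> bool" where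
  "has_coeff_deriv P P' x \<longleftrightarrow>
     (\<forall>m. ((\<lambda>y. coeff (P y) m) has_real_derivative coeff P' m) (at x))"

definition coeff_continuous_on :: "'a::topological_space set \<Rightarrow> ('a \<Rightarrow> real poly) \<Rightarrow> bool" where
  "coeff_continuous_on A P \<longleftrightarrow> (\<forall>m. continuous_on A (\<lambda>y. coeff (P y) m))"

lemma has_coeff_deriv_const: "has_coeff_deriv (\<lambda>_. P) 0 x"
  by (simp add: has_coeff_deriv_def)

lemma has_coeff_deriv_linear:
  assumes "(a has_real_derivative a') (at x)" "(b has_real_derivative b') (at x)"
  shows "has_coeff_deriv (\<lambda>y. [:a y, b y:]) [:a', b':] x"
  unfolding has_coeff_deriv_def
proof
  fix m show "((\<lambda>y. coeff [:a y, b y:] m) has_real_derivative coeff [:a', b':] m) (at x)"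
    using assms by (cases m; cases "m - 1") (auto simp: coeff_pCons)
qed

lemma has_coeff_deriv_smult:
  assumes "(a has_real_derivative a') (at x)" "has_coeff_deriv P P' x"
  shows "has_coeff_deriv (\<lambda>y. smult (a y) (P y)) (smult a' (P x) + smult (a x) P') x"
  using assms unfolding has_coeff_deriv_def by (auto intro!: derivative_eq_intros)

lemma has_coeff_deriv_mult:
  assumes "has_coeff_deriv P P' x" "has_coeff_deriv Q Q' x"
  shows "has_coeff_deriv (\<lambda>y. P y * Q y) (P' * Q x + P x * Q') x"
  unfolding has_coeff_deriv_def
proof
  fix m
  have "((\<lambda>y. \<Sum>i\<le>m. coeff (P y) i * coeff (Q y) (m - i)) has_real_derivative
      (\<Sum>i\<le>m. coeff P' i * coeff (Q x) (m - i) + coeff (P x) i * coeff Q' (m - i))) (at x)"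
    using assms unfolding has_coeff_deriv_def
    by (intro DERIV_sum) (auto intro!: derivative_eq_intros)
  then show "((\<lambda>y. coeff (P y * Q y) m) has_real_derivative coeff (P' * Q x + P x * Q') m) (at x)"
    by (simp add: coeff_mult sum.distrib)
qed

lemma has_coeff_deriv_sum:
  assumes "\<And>i. i \<in> A \<Longrightarrow> has_coeff_deriv (\<lambda>y. P y i) (P' i) x"
  shows "has_coeff_deriv (\<lambda>y. \<Sum>i\<in>A. P y i) (\<Sum>i\<in>A. P' i) x"
  using assms unfolding has_coeff_deriv_def
  by (auto simp: coeff_sum intro!: DERIV_sum)

lemma has_coeff_deriv_prod:
  assumes "finite A" "\<And>i. i \<in> A \<Longrightarrow> has_coeff_deriv (\<lambda>y. P y i) (P' i) x"
  shows "has_coeff_deriv (\<lambda>y. \<Prod>i\<in>A. P y i) (\<Sum>i\<in>A. P' i * (\<Prod>k\<in>A - {i}. P x k)) x"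
  using assms
proof (induction A rule: finite_induct)
  case empty
  then show ?case by (simp add: has_coeff_deriv_const)
next
  case (insert a A)
  have "has_coeff_deriv (\<lambda>y. P y a * (\<Prod>i\<in>A. P y i))
      (P' a * (\<Prod>i\<in>A. P x i) + P x a * (\<Sum>i\<in>A. P' i * (\<Prod>k\<in>A - {i}. P x k))) x"
    using insert by (intro has_coeff_deriv_mult) auto
  moreover have "P x a * (\<Sum>i\<in>A. P' i * (\<Prod>k\<in>A - {i}. P x k)) =
      (\<Sum>i\<in>A. P' i * (\<Prod>k\<in>insert a A - {i}. P x k))"
    unfolding sum_distrib_left
  proof (rule sum.cong)
    fix i assume "i \<in> A"
    then have "insert a A - {i} = insert a (A - {i})" "a \<notin> A - {i}" using insert by auto
    then show "P x a * (P' i * (\<Prod>k\<in>A - {i}. P x k)) = P' i * (\<Prod>k\<in>insert a A - {i}. P x k)"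
      using insert by (simp add: mult_ac)
  qed simp
  moreover have "insert a A - {a} = A" using insert by auto
  ultimately show ?case using insert by simp
qed

lemma coeff_continuous_on_linear:
  assumes "continuous_on A a" "continuous_on A b"
  shows "coeff_continuous_on A (\<lambda>y. [:a y, b y:])"
  unfolding coeff_continuous_on_def
proof
  fix m show "continuous_on A (\<lambda>y. coeff [:a y, b y:] m)"
    using assms by (cases m; cases "m - 1") (auto simp: coeff_pCons)
qed

lemma coeff_continuous_on_add:
  "coeff_continuous_on A P \<Longrightarrow> coeff_continuous_on A Q \<Longrightarrow> coeff_continuous_on A (\<lambda>y. P y + Q y)"
  unfolding coeff_continuous_on_def by (auto intro!: continuous_intros)

lemma coeff_continuous_on_smult:
  "continuous_on A a \<Longrightarrow> coeff_continuous_on A P \<Longrightarrow> coeff_continuous_on A (\<lambda>y. smult (a y) (P y))"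
  unfolding coeff_continuous_on_def by (auto intro!: continuous_intros)

lemma coeff_continuous_on_mult:
  "coeff_continuous_on A P \<Longrightarrow> coeff_continuous_on A Q \<Longrightarrow> coeff_continuous_on A (\<lambda>y. P y * Q y)"
  unfolding coeff_continuous_on_def coeff_mult by (auto intro!: continuous_intros)

lemma coeff_continuous_on_sum:
  "(\<And>i. i \<in> B \<Longrightarrow> coeff_continuous_on A (\<lambda>y. P y i)) \<Longrightarrow> coeff_continuous_on A (\<lambda>y. \<Sum>i\<in>B. P y i)"
  unfolding coeff_continuous_on_def coeff_sum by (auto intro!: continuous_intros)

lemma coeff_continuous_on_prod:
  assumes "\<And>i. i \<in> B \<Longrightarrow> coeff_continuous_on A (\<lambda>y. P y i)"
  shows "coeff_continuous_on A (\<lambda>y. \<Prod>i\<in>B. P y i)"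
  using assms
proof (induction B rule: infinite_finite_induct)
  case (insert b B)
  then show ?case by (simp add: coeff_continuous_on_mult)
qed (auto simp: coeff_continuous_on_def)

lemmas coeff_continuous_intros =
  coeff_continuous_on_linear coeff_continuous_on_add coeff_continuous_on_smult
  coeff_continuous_on_mult coeff_continuous_on_sum coeff_continuous_on_prod

text \<open>With nonnegative coefficients, a single coefficient is at most their sum, the value at \<open>z = 1\<close>.\<close>

lemma coeff_prod_linear_bounds:
  fixes a b :: "'i \<Rightarrow> real"
  assumes "\<And>i. i \<in> A \<Longrightarrow> 0 \<le> a i" "\<And>i. i \<in> A \<Longrightarrow> 0 \<le> b i"
  shows "0 \<le> coeff (\<Prod>i\<in>A. [:a i, b i:]) m \<and>
    coeff (\<Prod>i\<in>A. [:a i, b i:]) m \<le> (\<Prod>i\<in>A. a i + b i)"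
  using assms
proof (induction A arbitrary: m rule: infinite_finite_induct)
  case (insert k A)
  let ?P = "\<Prod>i\<in>A. [:a i, b i:]" and ?B = "\<Prod>i\<in>A. a i + b i"
  have IH: "0 \<le> coeff ?P n" "coeff ?P n \<le> ?B" for n
    using insert by auto
  have k: "0 \<le> a k" "0 \<le> b k" using insert by auto
  have eq: "coeff ([:a k, b k:] * ?P) m
      = a k * coeff ?P m + b k * (case m of 0 \<Rightarrow> 0 | Suc n \<Rightarrow> coeff ?P n)"
    by (simp add: mult_pCons_left coeff_pCons split: nat.split)
  have B: "0 \<le> ?B" using IH[of 0] by linarith
  have "0 \<le> (case m of 0 \<Rightarrow> 0 | Suc n \<Rightarrow> coeff ?P n)" "(case m of 0 \<Rightarrow> 0 | Suc n \<Rightarrow> coeff ?P n) \<le> ?B"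
    using IH B by (auto split: nat.split)
  then have "0 \<le> coeff ([:a k, b k:] * ?P) m" "coeff ([:a k, b k:] * ?P) m \<le> (a k + b k) * ?B"
    unfolding eq distrib_right using IH[of m] k by (auto intro!: add_mono mult_left_mono)
  then show ?case using insert by simp
qed (auto simp: coeff_1)

lemma coeff_prod_linear_pos:
  fixes a b :: "'i \<Rightarrow> real"
  assumes "finite A" "\<And>i. i \<in> A \<Longrightarrow> 0 < a i" "\<And>i. i \<in> A \<Longrightarrow> 0 < b i" "m \<le> card A"
  shows "0 < coeff (\<Prod>i\<in>A. [:a i, b i:]) m"
  using assms
proof (induction A arbitrary: m rule: finite_induct)
  case (insert k A)
  let ?P = "\<Prod>i\<in>A. [:a i, b i:]"
  have nonneg: "0 \<le> coeff ?P n" for n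
    using insert coeff_prod_linear_bounds[of A a b n] by (auto simp: less_imp_le)
  have k: "0 < a k" "0 < b k" using insert by auto
  have eq: "coeff ([:a k, b k:] * ?P) m
      = a k * coeff ?P m + b k * (case m of 0 \<Rightarrow> 0 | Suc n \<Rightarrow> coeff ?P n)"
    by (simp add: mult_pCons_left coeff_pCons split: nat.split)
  have "0 < coeff ([:a k, b k:] * ?P) m"
  proof (cases m)
    case 0
    then show ?thesis unfolding eq using insert k by auto
  next
    case (Suc n)
    then have "0 < coeff ?P n" using insert by auto
    then show ?thesis unfolding eq Suc using nonneg[of m] k Suc
      by (auto intro!: add_nonneg_pos)
  qed
  then show ?case using insert by simp
qed (auto simp: coeff_1)

lemma smult_sum_right: "smult a (\<Sum>i\<in>A. P i) = (\<Sum>i\<in>A. smult a (P i))"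
  by (induction A rule: infinite_finite_induct) (auto simp: smult_add_right)

lemma pCons_0_sum: "pCons 0 (\<Sum>i\<in>A. P i) = (\<Sum>i\<in>A. pCons 0 (P i))"
proof (induction A rule: infinite_finite_induct)
  case (insert a A)
  then show ?case by (simp flip: insert.IH)
qed auto

lemma poly_eq_sum_coeff: "degree p \<le> n \<Longrightarrow> poly p x = (\<Sum>m\<le>n. coeff p m * x ^ m)"
  for x :: "'a::comm_semiring_1"
  unfolding poly_altdef by (intro sum.mono_neutral_left) (auto simp: coeff_eq_0)

text \<open>Probability yields the generating function only for \<open>z \<ge> 0\<close>; infinitely many points are
  enough, since a nonzero polynomial has finitely many roots.\<close>

lemma coeffs_eqI_nonneg:
  fixes a b :: "nat \<Rightarrow> real"
  assumes "\<And>z. 0 \<le> z \<Longrightarrow> (\<Sum>m\<le>n. a m * z ^ m) = (\<Sum>m\<le>n. b m * z ^ m)" "m \<le> n"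
  shows "a m = b m"
proof -
  define p where "p = (\<Sum>m\<le>n. monom (a m - b m) m)"
  have "{0..} \<subseteq> {z. poly p z = 0}"
    using assms(1) by (auto simp: p_def poly_sum poly_monom left_diff_distrib sum_subtractf)
  then have "infinite {z. poly p z = 0}"
    using infinite_Ici finite_subset by blast
  then have "p = 0"
    using poly_roots_finite by blast
  moreover have "coeff p m = a m - b m"
    using assms(2) by (simp add: p_def coeff_sum)
  ultimately show ?thesis by simp
qed

section \<open>Poisson counts of a single type\<close>

text \<open>The probability that a Poisson variable with mean \<open>x\<close> lies in \<open>{1..<j}\<close>: a type that the main
  collector has, while collector \<open>j\<close> lacks it.\<close>

definition poisson_short :: "nat \<Rightarrow> real \<Rightarrow> real" where
  "poisson_short j x = exp (- x) * (\<Sum>c\<in>{1..<j}. x ^ c / fact c)"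

definition poisson_mass :: "nat \<Rightarrow> real \<Rightarrow> real" where
  "poisson_mass n x = exp (- x) * x ^ n / fact n"

text \<open>This is the polynomial \<open>W(x)\<close> in \<open>z\<close>.  Its value at \<open>z\<close> is the expectation, over a Poisson
  count with mean \<open>x\<close>, of the weight that is \<open>0\<close> for an unseen type, \<open>1 + z\<close> for a type seen at least once
  but fewer than \<open>j\<close> times, and \<open>1\<close> otherwise.\<close>

definition seen_poly :: "nat \<Rightarrow> real \<Rightarrow> real poly" where
  "seen_poly j x = [:1 - exp (- x), poisson_short j x:]"

text \<open>The derivative of \<open>exp(- x) \<Sum>c\<in>C. x ^ c / c!\<close> telescopes, leaving only the two ends of the
  range \<open>C = {1..<j}\<close>.\<close>

lemma poisson_short_deriv:
  assumes "1 \<le> j"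
  shows "(poisson_short j has_real_derivative exp (- x) - poisson_mass (j - 1) x) (at x)"
proof -
  have pw: "((\<lambda>x. x ^ c / fact c) has_real_derivative x ^ (c - 1) / fact (c - 1)) (at x)"
    if "1 \<le> c" for c :: nat
  proof -
    have "fact c = real c * fact (c - 1)"
      using that by (simp add: fact_reduce)
    then show ?thesis
      using that DERIV_cdivide[OF DERIV_pow[of c x], of "fact c"] by simp
  qed
  have deriv: "(poisson_short j has_real_derivative
      (- exp (- x)) * (\<Sum>c\<in>{1..<j}. x ^ c / fact c) + exp (- x) * (\<Sum>c\<in>{1..<j}. x ^ (c - 1) / fact (c - 1))) (at x)"
    unfolding poisson_short_def
    by (rule derivative_eq_intros DERIV_sum pw refl | simp)+
  have "(\<Sum>c\<in>{1..<j}. x ^ (c - 1) / fact (c - 1)) + x ^ (j - 1) / fact (j - 1) = 1 + (\<Sum>c\<in>{1..<j}. x ^ c / fact c)"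
    using assms
  proof (induction j rule: dec_induct)
    case (step n)
    then show ?case by (simp add: sum.atLeastLessThan_Suc)
  qed simp
  then have eq: "(\<Sum>c\<in>{1..<j}. x ^ (c - 1) / fact (c - 1)) =
      1 + (\<Sum>c\<in>{1..<j}. x ^ c / fact c) - x ^ (j - 1) / fact (j - 1)"
    by linarith
  show ?thesis
    by (rule DERIV_cong[OF deriv]) (simp only: eq, simp add: poisson_mass_def algebra_simps)
qed

lemma poisson_short_pos: "2 \<le> j \<Longrightarrow> 0 < x \<Longrightarrow> 0 < poisson_short j x"
  unfolding poisson_short_def by (intro mult_pos_pos sum_pos) auto

lemma poisson_short_nonneg: "0 \<le> x \<Longrightarrow> 0 \<le> poisson_short j x"
  unfolding poisson_short_def by (intro mult_nonneg_nonneg sum_nonneg) auto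

lemma poisson_short_le_1:
  assumes "0 \<le> x"
  shows "poisson_short j x \<le> 1"
proof -
  have "(\<Sum>c\<in>{1..<j}. x ^ c / fact c) \<le> (\<Sum>c. x ^ c / fact c)"
    using assms summable_exp[of x] by (intro sum_le_suminf) (auto simp: field_simps)
  also have "\<dots> = exp x"
    by (simp add: exp_def field_simps)
  finally show ?thesis
    unfolding poisson_short_def by (simp add: exp_minus field_simps)
qed

lemma continuous_on_poisson_short [continuous_intros]:
  "continuous_on A f \<Longrightarrow> continuous_on A (\<lambda>x. poisson_short j (f x))"
  unfolding poisson_short_def by (intro continuous_intros) auto

lemma continuous_on_poisson_mass [continuous_intros]:
  "continuous_on A f \<Longrightarrow> continuous_on A (\<lambda>x. poisson_mass n (f x))"
  unfolding poisson_mass_def by (intro continuous_intros) auto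

text \<open>This is the polynomial \<open>K(t)\<close>: type \<open>i\<close> arrives for the first time at time \<open>t\<close>, and all other
  types have been seen before.\<close>

definition excess_poly :: "nat \<Rightarrow> 'i set \<Rightarrow> ('i \<Rightarrow> real) \<Rightarrow> real \<Rightarrow> real poly" where
  "excess_poly j S q t =
     (\<Sum>i\<in>S. smult (q i * exp (- (q i * t))) (\<Prod>l\<in>S - {i}. seen_poly j (q l * t)))"

text \<open>The coefficientwise form of \<open>W' = (1 + z) E - z g\<close>.\<close>

definition seen_poly_deriv :: "nat \<Rightarrow> real \<Rightarrow> real poly" where
  "seen_poly_deriv j x = [:exp (- x), exp (- x) - poisson_mass (j - 1) x:]"

lemma has_coeff_deriv_seen_poly:
  assumes "1 \<le> j" "(f has_real_derivative f') (at x)"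
  shows "has_coeff_deriv (\<lambda>y. seen_poly j (f y)) (smult f' (seen_poly_deriv j (f x))) x"
proof -
  have "((\<lambda>y. 1 - exp (- f y)) has_real_derivative f' * exp (- f x)) (at x)"
    using assms(2) by (auto intro!: derivative_eq_intros)
  moreover have "((\<lambda>y. poisson_short j (f y)) has_real_derivative
      f' * (exp (- f x) - poisson_mass (j - 1) (f x))) (at x)"
    using DERIV_chain2[OF poisson_short_deriv[OF assms(1)] assms(2)] by (simp add: mult.commute)
  ultimately show ?thesis
    unfolding seen_poly_def seen_poly_deriv_def by (simp add: has_coeff_deriv_linear)
qed

lemma coeff_continuous_on_seen_poly:
  "continuous_on A f \<Longrightarrow> coeff_continuous_on A (\<lambda>x. seen_poly j (f x))"
  unfolding seen_poly_def by (intro coeff_continuous_intros continuous_intros)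

lemma coeff_continuous_on_seen_poly_deriv:
  "continuous_on A f \<Longrightarrow> coeff_continuous_on A (\<lambda>x. seen_poly_deriv j (f x))"
  unfolding seen_poly_deriv_def by (intro coeff_continuous_intros continuous_intros)

lemma coeff_prod_seen_poly_bounds:
  assumes "\<And>l. l \<in> A \<Longrightarrow> 0 \<le> x l"
  shows "0 \<le> coeff (\<Prod>l\<in>A. seen_poly j (x l)) m" (is ?lower)
    and "coeff (\<Prod>l\<in>A. seen_poly j (x l)) m \<le> 2 ^ card A" (is ?upper)
proof -
  note bounds = coeff_prod_linear_bounds[of A "\<lambda>l. 1 - exp (- x l)" "\<lambda>l. poisson_short j (x l)" m]
  show ?lower
    unfolding seen_poly_def using assms bounds by (simp add: poisson_short_nonneg)
  have "coeff (\<Prod>l\<in>A. seen_poly j (x l)) m \<le> (\<Prod>l\<in>A. 1 - exp (- x l) + poisson_short j (x l))"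
    unfolding seen_poly_def using assms bounds by (simp add: poisson_short_nonneg)
  also have "\<dots> \<le> (\<Prod>l\<in>A. 2)"
  proof (rule prod_mono)
    fix l assume "l \<in> A"
    then have "0 \<le> x l" using assms by simp
    then show "0 \<le> 1 - exp (- x l) + poisson_short j (x l)
        \<and> 1 - exp (- x l) + poisson_short j (x l) \<le> 2"
      using poisson_short_nonneg[of "x l" j] poisson_short_le_1[of "x l" j]
      by (smt (verit) exp_gt_zero exp_le_one_iff)
  qed
  finally show ?upper by simp
qed

lemma coeff_continuous_on_excess_poly:
  "(\<And>i. i \<in> S \<Longrightarrow> continuous_on A (\<lambda>x. q x i)) \<Longrightarrow> continuous_on A t \<Longrightarrow>
    coeff_continuous_on A (\<lambda>x. excess_poly j S (q x) (t x))"
  unfolding excess_poly_def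
  by (intro coeff_continuous_intros coeff_continuous_on_seen_poly continuous_intros) auto

lemma coeff_excess_poly_nonneg:
  assumes "\<And>i. i \<in> S \<Longrightarrow> 0 \<le> q i" "0 \<le> t"
  shows "0 \<le> coeff (excess_poly j S q t) m"
  unfolding excess_poly_def coeff_sum coeff_smult using assms
  by (intro sum_nonneg mult_nonneg_nonneg coeff_prod_seen_poly_bounds) auto

lemma degree_excess_poly_le: "finite S \<Longrightarrow> degree (excess_poly j S q t) \<le> card S"
  unfolding excess_poly_def
proof (intro degree_sum_le)
  fix i assume S: "finite S" "i \<in> S"
  have "degree (\<Prod>l\<in>S - {i}. seen_poly j (q l * t)) \<le> (\<Sum>l\<in>S - {i}. degree (seen_poly j (q l * t)))"
    using degree_prod_sum_le[of "S - {i}" "\<lambda>l. seen_poly j (q l * t)"] S by (simp add: comp_def)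
  also have "\<dots> \<le> (\<Sum>l\<in>S - {i}. 1)"
    by (intro sum_mono) (simp add: seen_poly_def)
  also have "\<dots> \<le> card S"
    using S by (simp add: card_Diff1_le)
  finally show "degree (smult (q i * exp (- (q i * t))) (\<Prod>l\<in>S - {i}. seen_poly j (q l * t))) \<le> card S"
    using degree_smult_le order.trans by blast
qed

section \<open>Monotonicity along a segment through a uniform law\<close>

text \<open>The segment runs from the constant weights \<open>u\<close> to \<open>u + d i\<close>.  Positivity of the weights at its two
  ends extends to all of it by convexity.\<close>

locale coupon_segment =
  fixes S :: "'i set" and j :: nat and u :: real and d :: "'i \<Rightarrow> real"
  assumes fin: "finite S" and j: "2 \<le> j" and u: "0 < u" and endpoint: "\<And>i. i \<in> S \<Longrightarrow> 0 < u + d i"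
begin

definition q :: "real \<Rightarrow> 'i \<Rightarrow> real" where "q \<theta> i = u + \<theta> * d i"

definition K :: "real \<Rightarrow> real \<Rightarrow> real poly" where "K \<theta> = excess_poly j S (q \<theta>)"

abbreviation E :: "real \<Rightarrow> real \<Rightarrow> 'i \<Rightarrow> real" where "E \<theta> t i \<equiv> exp (- (q \<theta> i * t))"
abbreviation G :: "real \<Rightarrow> real \<Rightarrow> 'i \<Rightarrow> real" where "G \<theta> t i \<equiv> poisson_mass (j - 1) (q \<theta> i * t)"
abbreviation W :: "real \<Rightarrow> real \<Rightarrow> 'i \<Rightarrow> real poly" where "W \<theta> t i \<equiv> seen_poly j (q \<theta> i * t)"
abbreviation W' :: "real \<Rightarrow> real \<Rightarrow> 'i \<Rightarrow> real poly" where
  "W' \<theta> t i \<equiv> seen_poly_deriv j (q \<theta> i * t)"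
abbreviation R :: "real \<Rightarrow> real \<Rightarrow> 'i \<Rightarrow> 'i \<Rightarrow> real poly" where
  "R \<theta> t i l \<equiv> (\<Prod>k\<in>S - {i} - {l}. W \<theta> t k)"

text \<open>The boundary term: its derivative \<open>B'\<close> in \<open>t\<close> is the main part of the derivative \<open>K'\<close> of \<open>K\<close> in
  \<open>\<theta>\<close>.  Formally \<open>B\<close> arises from \<open>K\<close> when the weight \<open>q i\<close> of the last type is replaced by its
  \<open>\<theta>\<close>-derivative \<open>d i\<close> and the result is multiplied by \<open>t\<close>.\<close>

definition B :: "real \<Rightarrow> real \<Rightarrow> real poly" where
  "B \<theta> t = (\<Sum>i\<in>S. smult (t * d i * E \<theta> t i) (\<Prod>l\<in>S - {i}. W \<theta> t l))"

definition K' :: "real \<Rightarrow> real \<Rightarrow> real poly" where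
  "K' \<theta> t = (\<Sum>i\<in>S. smult (d i * E \<theta> t i - q \<theta> i * E \<theta> t i * (t * d i)) (\<Prod>l\<in>S - {i}. W \<theta> t l)
     + smult (q \<theta> i * E \<theta> t i) (\<Sum>l\<in>S - {i}. smult (t * d l) (W' \<theta> t l) * R \<theta> t i l))"

definition B' :: "real \<Rightarrow> real \<Rightarrow> real poly" where
  "B' \<theta> t = (\<Sum>i\<in>S. smult (d i * E \<theta> t i - q \<theta> i * E \<theta> t i * (t * d i)) (\<Prod>l\<in>S - {i}. W \<theta> t l)
     + smult (t * d i * E \<theta> t i) (\<Sum>l\<in>S - {i}. smult (q \<theta> l) (W' \<theta> t l) * R \<theta> t i l))"

definition w :: "real \<Rightarrow> real \<Rightarrow> 'i \<Rightarrow> 'i \<Rightarrow> real" where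
  "w \<theta> t i l = t * u * (d l - d i) * (E \<theta> t i * G \<theta> t l - E \<theta> t l * G \<theta> t i) / 2"

definition gap :: "real \<Rightarrow> real \<Rightarrow> real poly" where
  "gap \<theta> t = (\<Sum>i\<in>S. \<Sum>l\<in>S. smult (w \<theta> t i l) (R \<theta> t i l))"

lemma K_deriv: "has_coeff_deriv (\<lambda>\<theta>. K \<theta> t) (K' \<theta> t) \<theta>"
  unfolding K_def excess_poly_def K'_def
proof (rule has_coeff_deriv_sum)
  fix i assume "i \<in> S"
  have q: "((\<lambda>\<theta>. q \<theta> l) has_real_derivative d l) (at \<theta>)"
    and qt: "((\<lambda>\<theta>. q \<theta> l * t) has_real_derivative t * d l) (at \<theta>)" for l
    unfolding q_def by (auto intro!: derivative_eq_intros)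
  have "((\<lambda>\<theta>. q \<theta> i * E \<theta> t i) has_real_derivative
      d i * E \<theta> t i - q \<theta> i * E \<theta> t i * (t * d i)) (at \<theta>)"
    by (auto intro!: derivative_eq_intros q)
  moreover have "has_coeff_deriv (\<lambda>\<theta>. \<Prod>l\<in>S - {i}. W \<theta> t l)
      (\<Sum>l\<in>S - {i}. smult (t * d l) (W' \<theta> t l) * R \<theta> t i l) \<theta>"
    using fin j by (intro has_coeff_deriv_prod has_coeff_deriv_seen_poly qt) auto
  ultimately show "has_coeff_deriv (\<lambda>\<theta>. smult (q \<theta> i * E \<theta> t i) (\<Prod>l\<in>S - {i}. W \<theta> t l))
      (smult (d i * E \<theta> t i - q \<theta> i * E \<theta> t i * (t * d i)) (\<Prod>l\<in>S - {i}. W \<theta> t l)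
       + smult (q \<theta> i * E \<theta> t i) (\<Sum>l\<in>S - {i}. smult (t * d l) (W' \<theta> t l) * R \<theta> t i l)) \<theta>"
    by (rule has_coeff_deriv_smult)
qed

lemma B_deriv: "has_coeff_deriv (B \<theta>) (B' \<theta> t) t"
  unfolding B_def B'_def
proof (rule has_coeff_deriv_sum)
  fix i assume "i \<in> S"
  have "((\<lambda>t. t * d i * E \<theta> t i) has_real_derivative
      d i * E \<theta> t i - q \<theta> i * E \<theta> t i * (t * d i)) (at t)"
    by (auto intro!: derivative_eq_intros)
  moreover have "((\<lambda>t. q \<theta> l * t) has_real_derivative q \<theta> l) (at t)" for l
    by (auto intro!: derivative_eq_intros)
  then have "has_coeff_deriv (\<lambda>t. \<Prod>l\<in>S - {i}. W \<theta> t l)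
      (\<Sum>l\<in>S - {i}. smult (q \<theta> l) (W' \<theta> t l) * R \<theta> t i l) t"
    using fin j by (intro has_coeff_deriv_prod has_coeff_deriv_seen_poly) auto
  ultimately show "has_coeff_deriv (\<lambda>t. smult (t * d i * E \<theta> t i) (\<Prod>l\<in>S - {i}. W \<theta> t l))
      (smult (d i * E \<theta> t i - q \<theta> i * E \<theta> t i * (t * d i)) (\<Prod>l\<in>S - {i}. W \<theta> t l)
       + smult (t * d i * E \<theta> t i) (\<Sum>l\<in>S - {i}. smult (q \<theta> l) (W' \<theta> t l) * R \<theta> t i l)) t"
    by (rule has_coeff_deriv_smult)
qed

lemma R_commute: "R \<theta> t i l = R \<theta> t l i"
  by (rule prod.cong) auto

text \<open>The difference \<open>K' - B'\<close> is a double sum with a weight that is antisymmetric in the two types \<open>i\<close>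
  and \<open>l\<close>.  Averaging it with its transpose cancels every contribution that is symmetric in \<open>i\<close> and
  \<open>l\<close>; only the part of \<open>W'\<close> that carries \<open>g\<close>, hence a factor \<open>z\<close>, survives.\<close>

lemma K'_eq: "K' \<theta> t = B' \<theta> t - pCons 0 (gap \<theta> t)"
proof -
  \<comment> \<open>The diagonal terms of \<open>a\<close> vanish, so sums over \<open>l \<noteq> i\<close> may be taken over all \<open>l\<close>.\<close>
  define a where "a i l = smult (t * u * (d l - d i) * E \<theta> t i) (W' \<theta> t l * R \<theta> t i l)" for i l
  have pair: "smult (1 / 2) (a i l + a l i) = - (pCons 0 (smult (w \<theta> t i l) (R \<theta> t i l)))" for i l
  proof -
    let ?c = "t * u * (d l - d i)"
    have "a i l + a l i = smult ?c ((smult (E \<theta> t i) (W' \<theta> t l) - smult (E \<theta> t l) (W' \<theta> t i)) * R \<theta> t i l)"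
      unfolding a_def R_commute[of \<theta> t l i]
      by (simp add: algebra_simps smult_diff_left smult_diff_right smult_add_left)
    also have "smult (E \<theta> t i) (W' \<theta> t l) - smult (E \<theta> t l) (W' \<theta> t i)
        = [:0, E \<theta> t l * G \<theta> t i - E \<theta> t i * G \<theta> t l:]"
      unfolding seen_poly_deriv_def by (simp add: algebra_simps)
    finally have "smult (1 / 2) (a i l + a l i)
        = pCons 0 (smult (1 / 2 * (?c * (E \<theta> t l * G \<theta> t i - E \<theta> t i * G \<theta> t l))) (R \<theta> t i l))"
      by simp
    also have "1 / 2 * (?c * (E \<theta> t l * G \<theta> t i - E \<theta> t i * G \<theta> t l))
        = - w \<theta> t i l"
      by (simp add: w_def field_simps)
    finally show ?thesis
      by simp
  qed
  have "K' \<theta> t - B' \<theta> t = (\<Sum>i\<in>S. \<Sum>l\<in>S - {i}. a i l)"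
    unfolding K'_def B'_def sum_subtractf[symmetric]
  proof (rule sum.cong)
    fix i
    have "smult (q \<theta> i * E \<theta> t i) (smult (t * d l) (W' \<theta> t l) * R \<theta> t i l)
        - smult (t * d i * E \<theta> t i) (smult (q \<theta> l) (W' \<theta> t l) * R \<theta> t i l) = a i l" for l
      unfolding a_def q_def by (simp add: smult_diff_left[symmetric] algebra_simps)
    then show "smult (d i * E \<theta> t i - q \<theta> i * E \<theta> t i * (t * d i)) (\<Prod>l\<in>S - {i}. W \<theta> t l)
        + smult (q \<theta> i * E \<theta> t i) (\<Sum>l\<in>S - {i}. smult (t * d l) (W' \<theta> t l) * R \<theta> t i l)
        - (smult (d i * E \<theta> t i - q \<theta> i * E \<theta> t i * (t * d i)) (\<Prod>l\<in>S - {i}. W \<theta> t l)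
        + smult (t * d i * E \<theta> t i) (\<Sum>l\<in>S - {i}. smult (q \<theta> l) (W' \<theta> t l) * R \<theta> t i l))
        = (\<Sum>l\<in>S - {i}. a i l)"
      by (simp add: smult_sum_right sum_subtractf[symmetric])
  qed simp
  also have "\<dots> = (\<Sum>i\<in>S. \<Sum>l\<in>S. a i l)"
    using fin by (intro sum.cong sum.mono_neutral_left) (auto simp: a_def)
  also have "\<dots> = smult (1 / 2) ((\<Sum>i\<in>S. \<Sum>l\<in>S. a i l) + (\<Sum>i\<in>S. \<Sum>l\<in>S. a l i))"
  proof -
    have "smult (1 / 2) (P + P) = P" for P :: "real poly"
      by (simp only: smult_add_right flip: smult_add_left) simp
    then show ?thesis
      using sum.swap[of "\<lambda>i l. a l i" S S] by simp
  qed
  also have "\<dots> = (\<Sum>i\<in>S. \<Sum>l\<in>S. smult (1 / 2) (a i l + a l i))"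
    by (simp add: sum.distrib smult_sum_right smult_add_right)
  also have "\<dots> = - pCons 0 (gap \<theta> t)"
    unfolding gap_def by (simp only: pair pCons_0_sum sum_negf)
  finally show ?thesis
    by (simp add: algebra_simps)
qed

lemma q_lower_bound:
  obtains \<epsilon> where "0 < \<epsilon>" "\<And>\<theta> i. i \<in> S \<Longrightarrow> 0 \<le> \<theta> \<Longrightarrow> \<theta> \<le> 1 \<Longrightarrow> \<epsilon> \<le> q \<theta> i"
proof
  let ?\<epsilon> = "Min (insert u ((\<lambda>i. u + d i) ` S))"
  show "0 < ?\<epsilon>" using fin u endpoint by auto
  fix \<theta> :: real and i assume *: "i \<in> S" "0 \<le> \<theta>" "\<theta> \<le> 1"
  have "?\<epsilon> = (1 - \<theta>) * ?\<epsilon> + \<theta> * ?\<epsilon>" by (simp add: algebra_simps)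
  also have "\<dots> \<le> (1 - \<theta>) * u + \<theta> * (u + d i)"
    using * fin by (intro add_mono mult_left_mono Min_le) auto
  also have "\<dots> = q \<theta> i" by (simp add: q_def algebra_simps)
  finally show "?\<epsilon> \<le> q \<theta> i" .
qed

lemma q_pos: "i \<in> S \<Longrightarrow> 0 \<le> \<theta> \<Longrightarrow> \<theta> \<le> 1 \<Longrightarrow> 0 < q \<theta> i"
  by (rule q_lower_bound) (blast intro: less_le_trans)

text \<open>Both exponentials in \<open>E(x i) g(x l)\<close> and \<open>E(x l) g(x i)\<close> combine to the same factor, so the sign is
  that of \<open>(d l - d i) (q l ^ (j - 1) - q i ^ (j - 1))\<close>.  The second factor has the sign of
  \<open>\<theta> (d l - d i)\<close>; for strictness \<open>j \<ge> 2\<close> is essential.\<close>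

lemma w_sign:
  assumes "i \<in> S" "l \<in> S" "0 \<le> \<theta>" "\<theta> \<le> 1" "0 \<le> t"
  shows "0 \<le> w \<theta> t i l"
    and "0 < t \<Longrightarrow> 0 < \<theta> \<Longrightarrow> d i \<noteq> d l \<Longrightarrow>
      0 < w \<theta> t i l"
proof -
  let ?n = "j - 1"
  have q: "0 < q \<theta> i" "0 < q \<theta> l" using assms q_pos by auto
  have eq: "w \<theta> t i l
      = (t * u * E \<theta> t i * E \<theta> t l * t ^ ?n / (2 * fact ?n)) * ((d l - d i) * (q \<theta> l ^ ?n - q \<theta> i ^ ?n))"
    unfolding w_def poisson_mass_def by (simp add: field_simps power_mult_distrib)
  have pw: "x ^ ?n < y ^ ?n" if "x < y" "0 < x" for x y :: real
    using that j by (intro power_strict_mono) auto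
  have d: "0 \<le> (d l - d i) * (q \<theta> l ^ ?n - q \<theta> i ^ ?n)"
  proof (cases "d i \<le> d l")
    case True
    then have "q \<theta> i \<le> q \<theta> l" using assms by (auto simp: q_def mult_left_mono)
    then show ?thesis using True q by (intro mult_nonneg_nonneg) (auto intro: power_mono)
  next
    case False
    then have "q \<theta> l \<le> q \<theta> i" using assms by (auto simp: q_def mult_left_mono)
    then show ?thesis using False q by (intro mult_nonpos_nonpos) (auto intro: power_mono)
  qed
  show "0 \<le> w \<theta> t i l"
    unfolding eq using d u assms by (intro mult_nonneg_nonneg[OF _ d]) auto
  assume *: "0 < t" "0 < \<theta>" "d i \<noteq> d l"
  have dpos: "0 < (d l - d i) * (q \<theta> l ^ ?n - q \<theta> i ^ ?n)"
  proof (cases "d i < d l")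
    case True
    then have "q \<theta> i < q \<theta> l" using * by (auto simp: q_def)
    then show ?thesis using True q pw by (intro mult_pos_pos) auto
  next
    case False
    then have "q \<theta> l < q \<theta> i" using * by (auto simp: q_def)
    moreover have "d l < d i" using False * by simp
    ultimately show ?thesis using q pw by (intro mult_neg_neg) auto
  qed
  show "0 < w \<theta> t i l"
    unfolding eq using u * by (intro mult_pos_pos[OF _ dpos]) auto
qed

lemma gap_nonneg:
  assumes "0 \<le> \<theta>" "\<theta> \<le> 1" "0 \<le> t"
  shows "0 \<le> coeff (gap \<theta> t) n"
  unfolding gap_def coeff_sum coeff_smult using assms
  by (intro sum_nonneg mult_nonneg_nonneg w_sign coeff_prod_seen_poly_bounds)
     (auto intro: less_imp_le q_pos)

text \<open>One pair of types with different weights suffices: the product over the other \<open>card S - 2\<close> types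
  has positive coefficients up to its full degree.\<close>

lemma gap_pos:
  assumes "0 < \<theta>" "\<theta> \<le> 1" "0 < t" "a \<in> S" "b \<in> S" "d a \<noteq> d b" "n + 2 \<le> card S"
  shows "0 < coeff (gap \<theta> t) n"
proof -
  have nonneg: "0 \<le> w \<theta> t i l * coeff (R \<theta> t i l) n"
    if "i \<in> S" "l \<in> S" for i l
    using assms that by (intro mult_nonneg_nonneg w_sign coeff_prod_seen_poly_bounds)
      (auto intro: less_imp_le q_pos)
  have "0 < w \<theta> t a b * coeff (R \<theta> t a b) n"
  proof (rule mult_pos_pos)
    have "card (S - {a} - {b}) = card S - 2"
      using assms fin by (auto simp: card_Diff_singleton_if)
    then have "n \<le> card (S - {a} - {b})" using assms by simp
    moreover have "0 < q \<theta> k * t" if "k \<in> S" for k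
      using assms that q_pos by simp
    ultimately show "0 < coeff (R \<theta> t a b) n"
      unfolding seen_poly_def using fin j
      by (intro coeff_prod_linear_pos) (auto intro: poisson_short_pos)
  qed (use assms w_sign(2) in auto)
  then have "0 < (\<Sum>l\<in>S. w \<theta> t a l * coeff (R \<theta> t a l) n)"
    using assms fin by (intro sum_pos2[where i = b]) (auto intro: nonneg)
  with \<open>a \<in> S\<close> have "0 < (\<Sum>i\<in>S. \<Sum>l\<in>S. w \<theta> t i l * coeff (R \<theta> t i l) n)"
    by (rule sum_pos2[OF fin]) (intro sum_nonneg nonneg)
  then show ?thesis
    unfolding gap_def coeff_sum coeff_smult .
qed

lemma continuous_coeffs:
  shows "continuous_on A (\<lambda>(\<theta>, t). coeff (K \<theta> t) m)"
    and "continuous_on A (\<lambda>(\<theta>, t). coeff (K' \<theta> t) m)"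
    and "continuous_on A (\<lambda>(\<theta>, t). coeff (gap \<theta> t) m)"
proof -
  have K: "coeff_continuous_on A (\<lambda>x. K (fst x) (snd x))"
    unfolding K_def excess_poly_def q_def
    by (intro coeff_continuous_intros coeff_continuous_on_seen_poly continuous_intros)
  have K': "coeff_continuous_on A (\<lambda>x. K' (fst x) (snd x))"
    unfolding K'_def q_def
    by (intro coeff_continuous_intros coeff_continuous_on_seen_poly
        coeff_continuous_on_seen_poly_deriv continuous_intros)
  have gap: "coeff_continuous_on A (\<lambda>x. gap (fst x) (snd x))"
    unfolding gap_def w_def q_def
    by (intro coeff_continuous_intros coeff_continuous_on_seen_poly continuous_intros) auto
  show "continuous_on A (\<lambda>(\<theta>, t). coeff (K \<theta> t) m)"
    "continuous_on A (\<lambda>(\<theta>, t). coeff (K' \<theta> t) m)"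
    "continuous_on A (\<lambda>(\<theta>, t). coeff (gap \<theta> t) m)"
    using K K' gap by (auto simp: coeff_continuous_on_def case_prod_beta)
qed

lemma continuous_coeffs_time:
  shows "continuous_on A (\<lambda>t. coeff (K \<theta> t) m)"
    and "continuous_on A (\<lambda>t. coeff (gap \<theta> t) m)"
proof -
  have pair: "continuous_on A (\<lambda>t. (\<theta>, t))"
    by (intro continuous_intros)
  show "continuous_on A (\<lambda>t. coeff (K \<theta> t) m)"
    using continuous_on_compose2[OF continuous_coeffs(1)[of UNIV m] pair] by simp
  show "continuous_on A (\<lambda>t. coeff (gap \<theta> t) m)"
    using continuous_on_compose2[OF continuous_coeffs(3)[of UNIV m] pair] by simp
qed

lemma continuous_on_coeff_pCons_gap: "continuous_on A (\<lambda>t. coeff (pCons 0 (gap \<theta> t)) m)"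
  using continuous_coeffs_time(2) by (cases m) auto

text \<open>The integral of \<open>B'\<close> over \<open>{0..T}\<close> is the value of \<open>B\<close> at \<open>T\<close>, which decays exponentially, with
  constants that are uniform in \<open>\<theta>\<close> because the weights stay away from \<open>0\<close> on the whole segment.\<close>

lemma integral_K'_le:
  obtains C \<epsilon> where "0 < \<epsilon>"
    "\<And>\<theta> T m. 0 \<le> \<theta> \<Longrightarrow> \<theta> \<le> 1 \<Longrightarrow> 0 \<le> T \<Longrightarrow> integral {0..T} (\<lambda>t. coeff (K' \<theta> t) m)
      \<le> C * (T * exp (- (\<epsilon> * T))) - integral {0..T} (\<lambda>t. coeff (pCons 0 (gap \<theta> t)) m)"
proof -
  obtain \<epsilon> where \<epsilon>: "0 < \<epsilon>" "\<And>\<theta> i. i \<in> S \<Longrightarrow> 0 \<le> \<theta> \<Longrightarrow> \<theta> \<le> 1 \<Longrightarrow> \<epsilon> \<le> q \<theta> i"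
    using q_lower_bound by blast
  define C where "C = (\<Sum>i\<in>S. \<bar>d i\<bar> * 2 ^ card S)"
  have bound: "integral {0..T} (\<lambda>t. coeff (K' \<theta> t) m)
      \<le> C * (T * exp (- (\<epsilon> * T))) - integral {0..T} (\<lambda>t. coeff (pCons 0 (gap \<theta> t)) m)"
    if \<theta>: "0 \<le> \<theta>" "\<theta> \<le> 1" and T: "0 \<le> T" for \<theta> T m
  proof -
    have "((\<lambda>t. coeff (B' \<theta> t) m) has_integral coeff (B \<theta> T) m - coeff (B \<theta> 0) m) {0..T}"
    proof (rule fundamental_theorem_of_calculus[OF T])
      fix t
      have "((\<lambda>t. coeff (B \<theta> t) m) has_real_derivative coeff (B' \<theta> t) m) (at t)"
        using B_deriv unfolding has_coeff_deriv_def by blast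
      then show "((\<lambda>t. coeff (B \<theta> t) m) has_vector_derivative coeff (B' \<theta> t) m) (at t within {0..T})"
        unfolding has_real_derivative_iff_has_vector_derivative[symmetric]
        by (rule has_field_derivative_at_within)
    qed
    moreover have "(\<lambda>t. coeff (pCons 0 (gap \<theta> t)) m) integrable_on {0..T}"
      by (intro integrable_continuous_real continuous_on_coeff_pCons_gap)
    ultimately have "((\<lambda>t. coeff (B' \<theta> t) m - coeff (pCons 0 (gap \<theta> t)) m) has_integral
        coeff (B \<theta> T) m - coeff (B \<theta> 0) m - integral {0..T} (\<lambda>t. coeff (pCons 0 (gap \<theta> t)) m)) {0..T}"
      by (intro has_integral_diff integrable_integral)
    moreover have "coeff (B \<theta> 0) m = 0"
      unfolding B_def by simp
    ultimately have "integral {0..T} (\<lambda>t. coeff (K' \<theta> t) m)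
        = coeff (B \<theta> T) m - integral {0..T} (\<lambda>t. coeff (pCons 0 (gap \<theta> t)) m)"
      unfolding K'_eq coeff_diff by (simp add: integral_unique)
    moreover have "coeff (B \<theta> T) m \<le> C * (T * exp (- (\<epsilon> * T)))"
      unfolding B_def C_def coeff_sum coeff_smult sum_distrib_right
    proof (rule sum_mono)
      fix i assume i: "i \<in> S"
      let ?P = "\<Prod>l\<in>S - {i}. W \<theta> T l"
      have nn: "0 \<le> q \<theta> l * T" if "l \<in> S - {i}" for l
        using q_pos[of l \<theta>] \<theta> T that by simp
      have P: "0 \<le> coeff ?P m" "coeff ?P m \<le> 2 ^ card (S - {i})"
        using coeff_prod_seen_poly_bounds[of "S - {i}" "\<lambda>l. q \<theta> l * T" j m, OF nn] by simp_all
      have "(2::real) ^ card (S - {i}) \<le> 2 ^ card S"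
        using fin by (intro power_increasing card_mono) auto
      then have P2: "coeff ?P m \<le> 2 ^ card S" using P by linarith
      have d: "T * d i \<le> T * \<bar>d i\<bar>"
        using T by (intro mult_left_mono) auto
      have e: "E \<theta> T i \<le> exp (- (\<epsilon> * T))"
        using mult_right_mono[OF \<epsilon>(2)[OF i \<theta>] T] by simp
      have "T * d i * E \<theta> T i \<le> T * \<bar>d i\<bar> * exp (- (\<epsilon> * T))"
        using T by (intro mult_mono[OF d e]) auto
      then have "T * d i * E \<theta> T i * coeff ?P m \<le> T * \<bar>d i\<bar> * exp (- (\<epsilon> * T)) * 2 ^ card S"
        by (rule mult_mono[OF _ P2 _ P(1)]) (use T in simp)
      then show "T * d i * E \<theta> T i * coeff ?P m \<le> \<bar>d i\<bar> * 2 ^ card S * (T * exp (- (\<epsilon> * T)))"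
        by (simp add: algebra_simps)
    qed
    ultimately show ?thesis by simp
  qed
  show ?thesis
    by (rule that[OF \<epsilon>(1) bound])
qed

text \<open>The mean value theorem in \<open>\<theta>\<close> is applied to the truncated integrals.  The intermediate point
  depends on \<open>T\<close>, which does no harm as the lower bound \<open>c\<close> on the integral of the gap holds along the
  whole segment.\<close>

lemma limit_decrease:
  assumes \<theta>: "0 \<le> \<theta>1" "\<theta>1 < \<theta>2" "\<theta>2 \<le> 1"
    and k1: "((\<lambda>T. integral {0..T} (\<lambda>t. coeff (K \<theta>1 t) m)) \<longlongrightarrow> k1) at_top"
    and k2: "((\<lambda>T. integral {0..T} (\<lambda>t. coeff (K \<theta>2 t) m)) \<longlongrightarrow> k2) at_top"
    and c: "\<And>\<theta> T. \<theta>1 \<le> \<theta> \<Longrightarrow> \<theta> \<le> \<theta>2 \<Longrightarrow> 2 \<le> T \<Longrightarrow>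
      c \<le> integral {0..T} (\<lambda>t. coeff (pCons 0 (gap \<theta> t)) m)"
  shows "k2 \<le> k1 - (\<theta>2 - \<theta>1) * c"
proof -
  obtain C \<epsilon> where \<epsilon>: "0 < \<epsilon>" and C:
    "\<And>\<theta> T m. 0 \<le> \<theta> \<Longrightarrow> \<theta> \<le> 1 \<Longrightarrow> 0 \<le> T \<Longrightarrow> integral {0..T} (\<lambda>t. coeff (K' \<theta> t) m)
      \<le> C * (T * exp (- (\<epsilon> * T))) - integral {0..T} (\<lambda>t. coeff (pCons 0 (gap \<theta> t)) m)"
    by (rule integral_K'_le) (rule that)
  let ?I = "\<lambda>\<theta> T. integral {0..T} (\<lambda>t. coeff (K \<theta> t) m)"
  have step: "?I \<theta>2 T \<le> ?I \<theta>1 T + (\<theta>2 - \<theta>1) * (C * (T * exp (- (\<epsilon> * T))) - c)" if T: "2 \<le> T" for T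
  proof -
    have deriv: "((\<lambda>\<theta>. ?I \<theta> T) has_real_derivative integral {0..T} (\<lambda>t. coeff (K' \<theta> t) m))
        (at \<theta> within {\<theta>1..\<theta>2})" if "\<theta> \<in> {\<theta>1..\<theta>2}" for \<theta>
    proof (rule leibniz_rule_field_derivative[of "{\<theta>1..\<theta>2}" 0 T "\<lambda>\<theta> t. coeff (K \<theta> t) m"
          "\<lambda>\<theta> t. coeff (K' \<theta> t) m", unfolded cbox_interval])
      fix \<theta> t
      have "((\<lambda>\<theta>. coeff (K \<theta> t) m) has_real_derivative coeff (K' \<theta> t) m) (at \<theta>)"
        using K_deriv unfolding has_coeff_deriv_def by blast
      then show "((\<lambda>\<theta>. coeff (K \<theta> t) m) has_real_derivative coeff (K' \<theta> t) m) (at \<theta> within {\<theta>1..\<theta>2})"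
        by (rule has_field_derivative_at_within)
      show "(\<lambda>t. coeff (K \<theta> t) m) integrable_on {0..T}"
        by (intro integrable_continuous_real continuous_coeffs_time)
    qed (rule continuous_coeffs that convex_real_interval)+
    obtain \<xi> where \<xi>: "\<xi> \<in> {\<theta>1<..<\<theta>2}"
      and eq: "?I \<theta>2 T - ?I \<theta>1 T = integral {0..T} (\<lambda>t. coeff (K' \<xi> t) m) * (\<theta>2 - \<theta>1)"
    proof (rule bexE[OF mvt_simple[OF \<theta>(2), of "\<lambda>\<theta>. ?I \<theta> T"
            "\<lambda>\<theta>. (*) (integral {0..T} (\<lambda>t. coeff (K' \<theta> t) m))"]])
      show "((\<lambda>\<theta>. ?I \<theta> T) has_derivative (*) (integral {0..T} (\<lambda>t. coeff (K' \<theta> t) m)))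
          (at \<theta> within {\<theta>1..\<theta>2})" if "\<theta>1 \<le> \<theta>" "\<theta> \<le> \<theta>2" for \<theta>
        using deriv[of \<theta>] that unfolding has_field_derivative_def by simp
    qed
    have "integral {0..T} (\<lambda>t. coeff (K' \<xi> t) m) \<le> C * (T * exp (- (\<epsilon> * T))) - c"
      using C[of \<xi> T m] c[of \<xi> T] \<xi> \<theta> T by auto
    then have "?I \<theta>2 T - ?I \<theta>1 T \<le> (C * (T * exp (- (\<epsilon> * T))) - c) * (\<theta>2 - \<theta>1)"
      unfolding eq using \<theta> by (intro mult_right_mono) auto
    then show ?thesis by (simp add: algebra_simps)
  qed
  have "((\<lambda>T. T * exp (- (\<epsilon> * T))) \<longlongrightarrow> 0) at_top"
    using \<epsilon> by real_asymp
  then have "((\<lambda>T. ?I \<theta>1 T + (\<theta>2 - \<theta>1) * (C * (T * exp (- (\<epsilon> * T))) - c)) \<longlongrightarrow>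
      k1 + (\<theta>2 - \<theta>1) * (C * 0 - c)) at_top"
    by (intro tendsto_intros k1)
  moreover have "\<forall>\<^sub>F T in at_top. ?I \<theta>2 T \<le> ?I \<theta>1 T + (\<theta>2 - \<theta>1) * (C * (T * exp (- (\<epsilon> * T))) - c)"
    using eventually_ge_at_top[of 2] by eventually_elim (rule step)
  ultimately have "k2 \<le> k1 + (\<theta>2 - \<theta>1) * (C * 0 - c)"
    using k2 by (intro tendsto_le[OF _ _ k2]) auto
  then show ?thesis by simp
qed

lemma limit_mono:
  assumes "0 \<le> \<theta>1" "\<theta>1 < \<theta>2" "\<theta>2 \<le> 1"
    and "((\<lambda>T. integral {0..T} (\<lambda>t. coeff (K \<theta>1 t) m)) \<longlongrightarrow> k1) at_top"
    and "((\<lambda>T. integral {0..T} (\<lambda>t. coeff (K \<theta>2 t) m)) \<longlongrightarrow> k2) at_top"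
  shows "k2 \<le> k1"
proof -
  have "0 \<le> integral {0..T} (\<lambda>t. coeff (pCons 0 (gap \<theta> t)) m)"
    if "\<theta>1 \<le> \<theta>" "\<theta> \<le> \<theta>2" for \<theta> T
  proof (rule integral_nonneg)
    show "0 \<le> coeff (pCons 0 (gap \<theta> t)) m" if "t \<in> {0..T}" for t
      using gap_nonneg[of \<theta> t] that \<open>\<theta>1 \<le> \<theta>\<close> \<open>\<theta> \<le> \<theta>2\<close> assms(1-3)
      by (auto simp: coeff_pCons split: nat.split)
  qed (intro integrable_continuous_real continuous_on_coeff_pCons_gap)
  then show ?thesis
    using limit_decrease[OF assms, of 0] by simp
qed

text \<open>At \<open>\<theta> = 0\<close> all weights agree and the gap vanishes, hence the assumption \<open>0 < \<theta>1\<close>.  On the compact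
  set of all \<open>\<theta>\<close> in the segment and all times \<open>t\<close> between \<open>1\<close> and \<open>2\<close> the gap has a positive minimum, and
  this time window alone provides the strict decrease.\<close>

lemma limit_strict_mono:
  assumes \<theta>: "0 < \<theta>1" "\<theta>1 < \<theta>2" "\<theta>2 \<le> 1"
    and lims: "((\<lambda>T. integral {0..T} (\<lambda>t. coeff (K \<theta>1 t) m)) \<longlongrightarrow> k1) at_top"
      "((\<lambda>T. integral {0..T} (\<lambda>t. coeff (K \<theta>2 t) m)) \<longlongrightarrow> k2) at_top"
    and ab: "a \<in> S" "b \<in> S" "d a \<noteq> d b" and m: "1 \<le> m" "m < card S"
  shows "k2 < k1"
proof -
  obtain n where n: "m = Suc n" using m by (cases m) auto
  let ?X = "{\<theta>1..\<theta>2} \<times> {1..2::real}"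
  have "compact ?X" "?X \<noteq> {}" using \<theta> by (auto intro: compact_Times)
  then obtain x where x: "x \<in> ?X"
    and min: "\<And>y. y \<in> ?X \<Longrightarrow> (\<lambda>(\<theta>, t). coeff (gap \<theta> t) n) x \<le> (\<lambda>(\<theta>, t). coeff (gap \<theta> t) n) y"
    using continuous_attains_inf[OF _ _ continuous_coeffs(3)[of ?X n]] by metis
  define c where "c = (\<lambda>(\<theta>, t). coeff (gap \<theta> t) n) x"
  have "0 < c"
    unfolding c_def using x gap_pos[of "fst x" "snd x" a b n] \<theta> ab m n by (auto simp: case_prod_beta)
  have "c \<le> integral {0..T} (\<lambda>t. coeff (pCons 0 (gap \<theta> t)) m)"
    if *: "\<theta>1 \<le> \<theta>" "\<theta> \<le> \<theta>2" "2 \<le> T" for \<theta> T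
  proof -
    have "c = integral {1..2::real} (\<lambda>_. c)" by simp
    also have "\<dots> \<le> integral {1..2} (\<lambda>t. coeff (gap \<theta> t) n)"
    proof (rule integral_le[of "\<lambda>_. c" "{1..2}" "\<lambda>t. coeff (gap \<theta> t) n"])
      fix t :: real assume "t \<in> {1..2}"
      then show "c \<le> coeff (gap \<theta> t) n"
        using min[of "(\<theta>, t)"] * by (simp add: c_def)
    qed (intro integrable_continuous_real continuous_coeffs_time continuous_on_const)+
    also have "\<dots> \<le> integral {0..T} (\<lambda>t. coeff (gap \<theta> t) n)"
    proof (rule integral_subset_le)
      show "\<forall>t\<in>{0..T}. 0 \<le> coeff (gap \<theta> t) n"
        using gap_nonneg[of \<theta>] * \<theta> by simp
    qed (use * in \<open>auto intro!: integrable_continuous_real continuous_coeffs_time\<close>)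
    finally show ?thesis by (simp add: n)
  qed
  then have "k2 \<le> k1 - (\<theta>2 - \<theta>1) * c"
    using \<theta> lims by (intro limit_decrease) auto
  then show ?thesis using \<open>0 < c\<close> \<theta> by (smt (verit) mult_pos_pos)
qed

end

section \<open>Power series and Poissonization\<close>

lemma fps_nth_prod_0: "fps_nth (\<Prod>i\<in>A. F i) 0 = (\<Prod>i\<in>A. fps_nth (F i) 0)"
  for F :: "'i \<Rightarrow> 'a::comm_ring_1 fps"
  by (induction A rule: infinite_finite_induct) auto

lemma fps_nth_prod_nonneg:
  fixes F :: "'i \<Rightarrow> real fps"
  assumes "\<And>i n. i \<in> A \<Longrightarrow> 0 \<le> fps_nth (F i) n"
  shows "0 \<le> fps_nth (\<Prod>i\<in>A. F i) n"
proof (cases "finite A")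
  case True
  then show ?thesis
    unfolding fps_prod_nth'[OF True] using assms by (intro sum_nonneg prod_nonneg) auto
qed simp

lemma fps_deriv_prod:
  fixes F :: "'i \<Rightarrow> 'a::comm_ring_1 fps"
  assumes "finite A"
  shows "fps_deriv (\<Prod>i\<in>A. F i) = (\<Sum>i\<in>A. fps_deriv (F i) * (\<Prod>k\<in>A - {i}. F k))"
  using assms
proof (induction A rule: finite_induct)
  case (insert a A)
  have "F a * (\<Sum>i\<in>A. fps_deriv (F i) * (\<Prod>k\<in>A - {i}. F k)) =
      (\<Sum>i\<in>A. fps_deriv (F i) * (\<Prod>k\<in>insert a A - {i}. F k))"
    unfolding sum_distrib_left
  proof (rule sum.cong)
    fix i assume "i \<in> A"
    then have "insert a A - {i} = insert a (A - {i})" "a \<notin> A - {i}" using insert by auto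
    then show "F a * (fps_deriv (F i) * (\<Prod>k\<in>A - {i}. F k)) =
        fps_deriv (F i) * (\<Prod>k\<in>insert a A - {i}. F k)"
      using insert by (simp add: mult_ac)
  qed simp
  moreover have "insert a A - {a} = A" using insert by auto
  ultimately show ?case using insert by (simp add: algebra_simps)
qed simp

text \<open>The exponential generating function of the weights \<open>\<phi> c\<close>, where \<open>c\<close> counts the occurrences of a
  letter of probability \<open>r\<close>.\<close>

definition egf :: "(nat \<Rightarrow> real) \<Rightarrow> real \<Rightarrow> real fps" where
  "egf \<phi> r = Abs_fps (\<lambda>c. \<phi> c * r ^ c / fact c)"

lemma fps_nth_egf: "fps_nth (egf \<phi> r) c = \<phi> c * r ^ c / fact c"
  by (simp add: egf_def)

text \<open>Differentiation corresponds to drawing one coupon of this type: it shifts the count by one at the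
  cost of a factor \<open>r\<close>.\<close>

lemma fps_deriv_egf: "fps_deriv (egf \<phi> r) = fps_const r * egf (\<lambda>c. \<phi> (Suc c)) r"
  by (rule fps_ext) (simp add: fps_nth_egf field_simps del: of_nat_Suc)

lemma fps_conv_radius_prod:
  fixes F :: "'i \<Rightarrow> real fps"
  assumes "\<And>i. i \<in> A \<Longrightarrow> fps_conv_radius (F i) = \<infinity>"
  shows "fps_conv_radius (\<Prod>i\<in>A. F i) = \<infinity>"
  using assms
proof (induction A rule: infinite_finite_induct)
  case (insert a A)
  then show ?case using fps_conv_radius_mult[of "F a" "\<Prod>i\<in>A. F i"] by simp
qed simp_all

lemma eval_fps_prod:
  fixes F :: "'i \<Rightarrow> real fps"
  assumes "\<And>i. i \<in> A \<Longrightarrow> fps_conv_radius (F i) = \<infinity>"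
  shows "eval_fps (\<Prod>i\<in>A. F i) t = (\<Prod>i\<in>A. eval_fps (F i) t)"
  using assms
proof (induction A rule: infinite_finite_induct)
  case (insert a A)
  moreover have "fps_conv_radius (\<Prod>i\<in>A. F i) = \<infinity>"
    using insert by (intro fps_conv_radius_prod) auto
  ultimately show ?case by (simp add: eval_fps_mult)
qed simp_all

text \<open>Poissonization: the weight \<open>exp(- t) t ^ n / n!\<close> of having drawn \<open>n\<close> coupons by time \<open>t\<close>
  integrates to \<open>1\<close> over all \<open>t \<ge> 0\<close>.\<close>

lemma suminf_fact_fps_eq_nn_integral:
  fixes F :: "real fps"
  assumes "\<And>n. 0 \<le> fps_nth F n" "fps_conv_radius F = \<infinity>"
  shows "(\<Sum>n. ennreal (fact n * fps_nth F n)) =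
    (\<integral>\<^sup>+t. ennreal (exp (- t) * eval_fps F t) * indicator {0..} t \<partial>lborel)"
proof -
  have "ennreal (fact n * fps_nth F n) =
      (\<integral>\<^sup>+t. ennreal (fps_nth F n) * (ennreal (t ^ n * exp (- t)) * indicator {0..} t) \<partial>lborel)" for n
  proof -
    have "(\<integral>\<^sup>+t. ennreal (fps_nth F n) * (ennreal (t ^ n * exp (- t)) * indicator {0..} t) \<partial>lborel)
        = ennreal (fps_nth F n) * ennreal (fact n)"
      by (subst nn_integral_cmult) (measurable, simp only: nn_intergal_power_times_exp_Ici of_nat_fact)
    then show ?thesis
      by (simp only: ennreal_mult'[OF fact_ge_zero] mult.commute[of "ennreal (fact n)"])
  qed
  then have "(\<Sum>n. ennreal (fact n * fps_nth F n)) =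
      (\<integral>\<^sup>+t. (\<Sum>n. ennreal (fps_nth F n) * (ennreal (t ^ n * exp (- t)) * indicator {0..} t)) \<partial>lborel)"
    by (simp add: nn_integral_suminf)
  also have "\<dots> = (\<integral>\<^sup>+t. ennreal (exp (- t) * eval_fps F t) * indicator {0..} t \<partial>lborel)"
  proof (rule nn_integral_cong)
    fix t :: real
    show "(\<Sum>n. ennreal (fps_nth F n) * (ennreal (t ^ n * exp (- t)) * indicator {0..} t)) =
        ennreal (exp (- t) * eval_fps F t) * indicator {0..} t"
    proof (cases "0 \<le> t")
      case True
      have "(\<lambda>n. fps_nth F n * t ^ n) sums eval_fps F t"
        unfolding eval_fps_def using assms(2) by (intro summable_sums summable_fps) simp
      then have "(\<lambda>n. exp (- t) * (fps_nth F n * t ^ n)) sums (exp (- t) * eval_fps F t)"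
        by (rule sums_mult)
      then have "(\<Sum>n. ennreal (exp (- t) * (fps_nth F n * t ^ n))) = ennreal (exp (- t) * eval_fps F t)"
        using True assms(1) by (intro suminf_ennreal_eq) auto
      moreover have "ennreal (fps_nth F n) * ennreal (t ^ n * exp (- t))
          = ennreal (exp (- t) * (fps_nth F n * t ^ n))" for n
        using True assms(1)[of n] by (simp add: ennreal_mult'[symmetric] mult_ac)
      ultimately show ?thesis using True by simp
    qed simp
  qed
  finally show ?thesis .
qed

section \<open>Words of independent coupons\<close>

definition cnt :: "nat \<Rightarrow> (nat \<Rightarrow> nat) \<Rightarrow> nat \<Rightarrow> nat" where
  "cnt n \<omega> i = card {s. s < n \<and> \<omega> s = i}"

lemma cnt_0 [simp]: "cnt 0 \<omega> i = 0"
  by (simp add: cnt_def)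

lemma cnt_Suc: "cnt (Suc n) \<omega> i = cnt n \<omega> i + of_bool (\<omega> n = i)"
proof -
  have "{s. s < Suc n \<and> \<omega> s = i} = {s. s < n \<and> \<omega> s = i} \<union> (if \<omega> n = i then {n} else {})"
    by (auto simp: less_Suc_eq)
  then show ?thesis by (auto simp: cnt_def)
qed

lemma cnt_case_nat: "cnt (Suc n) (case_nat a \<omega>) i = cnt n \<omega> i + of_bool (a = i)"
  by (induction n) (simp_all add: cnt_Suc)

lemma cnt_pos_iff: "0 < cnt n \<omega> i \<longleftrightarrow> (\<exists>s<n. \<omega> s = i)"
  by (auto simp: cnt_def card_gt_0_iff)

definition seen_weight :: "nat \<Rightarrow> real \<Rightarrow> nat \<Rightarrow> real" where
  "seen_weight j z c = (if c = 0 then 0 else if c < j then 1 + z else 1)"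

lemma egf_unseen: "egf (\<lambda>c. of_bool (c = 0)) r = 1"
  by (rule fps_ext) (simp add: fps_nth_egf)

lemma egf_seen_weight: "egf (seen_weight j z) r =
    fps_exp r - 1 + fps_of_poly (\<Sum>c\<in>{1..<j}. monom (z * r ^ c / fact c) c)"
proof (rule fps_ext)
  fix n
  have "coeff (\<Sum>c\<in>{1..<j}. monom (z * r ^ c / fact c) c) n
      = (\<Sum>c\<in>{1..<j}. if c = n then z * r ^ n / fact n else 0)"
    by (simp add: coeff_sum)
  then show "fps_nth (egf (seen_weight j z) r) n = fps_nth (fps_exp r - 1 +
      fps_of_poly (\<Sum>c\<in>{1..<j}. monom (z * r ^ c / fact c) c)) n"
    by (auto simp: fps_nth_egf seen_weight_def add_divide_distrib distrib_right)
qed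

lemma fps_conv_radius_egf_seen_weight: "fps_conv_radius (egf (seen_weight j z) r) = \<infinity>"
  unfolding egf_seen_weight
proof -
  have "fps_conv_radius (fps_exp r - 1) = \<infinity>"
    using fps_conv_radius_diff[of "fps_exp r" 1] by simp
  then show "fps_conv_radius (fps_exp r - 1 +
      fps_of_poly (\<Sum>c\<in>{1..<j}. monom (z * r ^ c / fact c) c)) = \<infinity>"
    using fps_conv_radius_add[of "fps_exp r - 1" "fps_of_poly (\<Sum>c\<in>{1..<j}. monom (z * r ^ c / fact c) c)"]
    by simp
qed

text \<open>The exponential factor turns the generating function of the counts into a Poisson expectation.\<close>

lemma eval_egf_seen_weight:
  "exp (- (r * t)) * eval_fps (egf (seen_weight j z) r) t = poly (seen_poly j (r * t)) z"
proof -
  have rad: "fps_conv_radius (fps_exp r - 1) = \<infinity>"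
    using fps_conv_radius_diff[of "fps_exp r" 1] by simp
  have eq: "eval_fps (egf (seen_weight j z) r) t
      = exp (r * t) - 1 + z * (\<Sum>c\<in>{1..<j}. (r * t) ^ c / fact c)"
    unfolding egf_seen_weight
    by (simp add: eval_fps_add eval_fps_diff rad poly_sum poly_monom sum_distrib_left
        power_mult_distrib mult_ac)
  have "exp (- (r * t)) * eval_fps (egf (seen_weight j z) r) t
      = exp (- (r * t)) * exp (r * t) - exp (- (r * t))
        + z * (exp (- (r * t)) * (\<Sum>c\<in>{1..<j}. (r * t) ^ c / fact c))"
    unfolding eq by (simp add: algebra_simps)
  also have "exp (- (r * t)) * exp (r * t) = 1"
    by (simp add: mult_exp_exp)
  finally show ?thesis
    unfolding seen_poly_def poisson_short_def by simp
qed

locale coupon_law =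
  fixes N :: nat and q :: "nat \<Rightarrow> real"
  assumes q_pos: "\<And>i. i \<in> {1..N} \<Longrightarrow> 0 < q i" and q_sum: "(\<Sum>i\<in>{1..N}. q i) = 1"
begin

definition letter :: "nat measure" where
  "letter = point_measure {1..N} (\<lambda>i. ennreal (q i))"

abbreviation P :: "(nat \<Rightarrow> nat) measure" where "P \<equiv> coupon_space N q"

lemma P_eq: "P = (\<Pi>\<^sub>M t\<in>(UNIV :: nat set). letter)"
  by (simp add: coupon_space_def letter_def)

lemma prob_space_letter: "prob_space letter"
  unfolding letter_def
proof (rule prob_space_point_measure)
  show "(\<Sum>i\<in>{1..N}. ennreal (q i)) = 1"
    using q_pos q_sum by (subst sum_ennreal) (auto intro: less_imp_le)
qed auto

sublocale letters: sequence_space letter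
  unfolding sequence_space_def by (intro product_prob_spaceI prob_space_letter)

lemma prob_space_P: "prob_space P"
  unfolding P_eq by (rule letters.P.prob_space_axioms)

lemma sets_letter: "sets letter = sets (count_space {1..N})"
  by (simp add: letter_def sets_point_measure)

lemma space_P: "\<omega> \<in> space P \<Longrightarrow> \<omega> s \<in> {1..N}"
  by (auto simp: P_eq space_PiM letter_def space_point_measure PiE_iff)

lemma measurable_coupon [measurable]: "(\<lambda>\<omega>. \<omega> s) \<in> P \<rightarrow>\<^sub>M count_space UNIV"
proof -
  have "(\<lambda>\<omega>. \<omega> s) \<in> P \<rightarrow>\<^sub>M letter"
    unfolding P_eq by (rule measurable_component_singleton) simp
  then have "(\<lambda>\<omega>. \<omega> s) \<in> P \<rightarrow>\<^sub>M count_space {1..N}"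
    unfolding measurable_cong_sets[OF refl sets_letter] .
  then show ?thesis
    by (rule measurable_compose) simp
qed

lemma measurable_cnt [measurable]: "(\<lambda>\<omega>. cnt n \<omega> i) \<in> P \<rightarrow>\<^sub>M count_space UNIV"
proof (induction n)
  case (Suc n)
  have "Measurable.pred P (\<lambda>\<omega>. \<omega> n = i)"
    by (rule measurable_compose[OF measurable_coupon]) simp
  moreover have "(\<lambda>\<omega>. Suc (cnt n \<omega> i)) \<in> P \<rightarrow>\<^sub>M count_space UNIV"
    by (rule measurable_compose[OF Suc]) simp
  ultimately have "(\<lambda>\<omega>. if \<omega> n = i then Suc (cnt n \<omega> i) else cnt n \<omega> i) \<in> P \<rightarrow>\<^sub>M count_space UNIV"
    using Suc by (intro measurable_If) (auto simp: pred_def)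
  also have "(\<lambda>\<omega>. if \<omega> n = i then Suc (cnt n \<omega> i) else cnt n \<omega> i) = (\<lambda>\<omega>. cnt (Suc n) \<omega> i)"
    by (simp add: fun_eq_iff cnt_Suc)
  finally show ?case .
qed simp

text \<open>Removing the first coupon of an independent sequence leaves a sequence with the same law.\<close>

lemma nn_integral_first_coupon:
  assumes [measurable]: "f \<in> borel_measurable P"
  shows "(\<integral>\<^sup>+\<omega>. f \<omega> \<partial>P) = (\<Sum>a\<in>{1..N}. ennreal (q a) * (\<integral>\<^sup>+\<omega>. f (case_nat a \<omega>) \<partial>P))"
proof -
  let ?S = "\<Pi>\<^sub>M t\<in>(UNIV :: nat set). letter"
  have f: "f \<in> borel_measurable ?S" using assms by (simp add: P_eq)
  have "(\<integral>\<^sup>+\<omega>. f \<omega> \<partial>?S) = (\<integral>\<^sup>+\<omega>. f \<omega> \<partial>distr (letter \<Otimes>\<^sub>M ?S) ?S (\<lambda>(s, \<omega>). case_nat s \<omega>))"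
    by (simp only: letters.PiM_iter)
  also have "\<dots> = (\<integral>\<^sup>+x. f (case x of (s, \<omega>) \<Rightarrow> case_nat s \<omega>) \<partial>(letter \<Otimes>\<^sub>M ?S))"
    by (rule nn_integral_distr) (use f in measurable)
  also have "\<dots> = (\<integral>\<^sup>+a. \<integral>\<^sup>+\<omega>. f (case_nat a \<omega>) \<partial>?S \<partial>letter)"
    using f by (subst letters.P.nn_integral_fst[symmetric]) auto
  also have "\<dots> = (\<Sum>a\<in>{1..N}. ennreal (q a) * (\<integral>\<^sup>+\<omega>. f (case_nat a \<omega>) \<partial>?S))"
    unfolding letter_def by (subst nn_integral_point_measure_finite) simp_all
  finally show ?thesis by (simp only: P_eq)
qed

text \<open>The expectation of a product of functions of the counts is \<open>n!\<close> times the coefficient of the product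
  of the generating functions.  Conditioning on the first coupon shifts one of the functions \<open>\<phi> k\<close>, which
  matches the product rule for the derivative of the generating function; therefore the induction has to
  be over arbitrary \<open>\<phi>\<close>.  The factor \<open>q i\<close> is the probability of the coupon drawn after these \<open>n\<close>.\<close>

lemma nn_integral_words:
  assumes "i \<in> {1..N}" "\<And>k c. 0 \<le> \<phi> k c"
  shows "(\<integral>\<^sup>+\<omega>. ennreal (of_bool (\<omega> n = i) * (\<Prod>k\<in>{1..N}. \<phi> k (cnt n \<omega> k))) \<partial>P) =
    ennreal (q i * (fact n * fps_nth (\<Prod>k\<in>{1..N}. egf (\<phi> k) (q k)) n))"
  using assms(2)
proof (induction n arbitrary: \<phi>)
  case 0
  interpret prob_space P by (rule prob_space_P)
  have q: "0 \<le> q i" using assms q_pos less_imp_le by blast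
  have "(\<integral>\<^sup>+\<omega>. ennreal (of_bool (\<omega> 0 = i) * (\<Prod>k\<in>{1..N}. \<phi> k (cnt 0 \<omega> k))) \<partial>P) =
      (\<Sum>a\<in>{1..N}. ennreal (q a) * ennreal (of_bool (a = i) * (\<Prod>k\<in>{1..N}. \<phi> k 0)))"
    by (subst nn_integral_first_coupon) (simp_all add: emeasure_space_1)
  also have "\<dots> = (\<Sum>a\<in>{1..N}. if a = i then ennreal (q i) * ennreal (\<Prod>k\<in>{1..N}. \<phi> k 0) else 0)"
    by (rule sum.cong) auto
  also have "\<dots> = ennreal (q i * (\<Prod>k\<in>{1..N}. \<phi> k 0))"
    using assms(1) q by (simp add: ennreal_mult')
  finally show ?case
    by (simp add: fps_nth_prod_0 fps_nth_egf)
next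
  case (Suc n)
  let ?\<phi> = "\<lambda>a k c. \<phi> k (c + of_bool (a = k))"
  let ?A = "\<lambda>\<phi>. \<Prod>k\<in>{1..N}. egf (\<phi> k) (q k)"
  have q: "0 \<le> q a" if "a \<in> {1..N}" for a using that q_pos less_imp_le by blast
  have nn: "0 \<le> fps_nth (?A (?\<phi> a)) n" for a
    using Suc.prems q by (intro fps_nth_prod_nonneg) (auto simp: fps_nth_egf)
  have "(\<integral>\<^sup>+\<omega>. ennreal (of_bool (\<omega> (Suc n) = i) * (\<Prod>k\<in>{1..N}. \<phi> k (cnt (Suc n) \<omega> k))) \<partial>P) =
      (\<Sum>a\<in>{1..N}. ennreal (q a) * (\<integral>\<^sup>+\<omega>. ennreal (of_bool (\<omega> n = i) *
        (\<Prod>k\<in>{1..N}. ?\<phi> a k (cnt n \<omega> k))) \<partial>P))"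
    by (subst nn_integral_first_coupon) (simp_all add: cnt_case_nat)
  also have "\<dots> = (\<Sum>a\<in>{1..N}. ennreal (q a * (q i * (fact n * fps_nth (?A (?\<phi> a)) n))))"
  proof (rule sum.cong)
    fix a assume "a \<in> {1..N}"
    moreover have "(\<integral>\<^sup>+\<omega>. ennreal (of_bool (\<omega> n = i) * (\<Prod>k\<in>{1..N}. ?\<phi> a k (cnt n \<omega> k))) \<partial>P)
        = ennreal (q i * (fact n * fps_nth (?A (?\<phi> a)) n))"
      using Suc.prems by (intro Suc.IH)
    ultimately show "ennreal (q a) * (\<integral>\<^sup>+\<omega>. ennreal (of_bool (\<omega> n = i) *
        (\<Prod>k\<in>{1..N}. ?\<phi> a k (cnt n \<omega> k))) \<partial>P)
        = ennreal (q a * (q i * (fact n * fps_nth (?A (?\<phi> a)) n)))"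
      by (simp only: ennreal_mult'[OF q])
  qed simp
  also have "\<dots> = ennreal (\<Sum>a\<in>{1..N}. q a * (q i * (fact n * fps_nth (?A (?\<phi> a)) n)))"
    using q assms(1) nn by (intro sum_ennreal mult_nonneg_nonneg) auto
  also have "(\<Sum>a\<in>{1..N}. q a * (q i * (fact n * fps_nth (?A (?\<phi> a)) n)))
      = q i * (fact n * fps_nth (fps_deriv (?A \<phi>)) n)"
  proof -
    have "fps_deriv (?A \<phi>) = (\<Sum>a\<in>{1..N}. fps_const (q a) * ?A (?\<phi> a))"
      unfolding fps_deriv_prod[OF finite_atLeastAtMost]
    proof (rule sum.cong)
      fix a assume a: "a \<in> {1..N}"
      have "?A (?\<phi> a) = egf (?\<phi> a a) (q a) * (\<Prod>k\<in>{1..N} - {a}. egf (?\<phi> a k) (q k))"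
        using a by (intro prod.remove) auto
      also have "(\<Prod>k\<in>{1..N} - {a}. egf (?\<phi> a k) (q k)) = (\<Prod>k\<in>{1..N} - {a}. egf (\<phi> k) (q k))"
        by (rule prod.cong) auto
      finally show "fps_deriv (egf (\<phi> a) (q a)) * (\<Prod>k\<in>{1..N} - {a}. egf (\<phi> k) (q k))
          = fps_const (q a) * ?A (?\<phi> a)"
        by (simp add: fps_deriv_egf mult.assoc)
    qed simp
    then show ?thesis
      by (simp add: fps_sum_nth sum_distrib_left mult_ac)
  qed
  also have "fact n * fps_nth (fps_deriv (?A \<phi>)) n = fact (Suc n) * fps_nth (?A \<phi>) (Suc n)"
    by (simp add: mult_ac)
  finally show ?case .
qed

text \<open>With these weights the product over \<open>k\<close> of the functions of the counts vanishes unless \<open>i\<close> is the only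
  type that is missing, and then it is \<open>(1 + z)\<close> to the number of other types seen fewer than \<open>j\<close> times.\<close>

definition arrival_weight :: "nat \<Rightarrow> real \<Rightarrow> nat \<Rightarrow> nat \<Rightarrow> nat \<Rightarrow> real" where
  "arrival_weight j z i k = (if k = i then (\<lambda>c. of_bool (c = 0)) else seen_weight j z)"

lemma suminf_words_eq_nn_integral:
  assumes "0 \<le> z"
  shows "(\<Sum>n. \<Sum>i\<in>{1..N}. \<integral>\<^sup>+\<omega>. ennreal (of_bool (\<omega> n = i) *
      (\<Prod>k\<in>{1..N}. arrival_weight j z i k (cnt n \<omega> k))) \<partial>P) =
    (\<integral>\<^sup>+t. ennreal (poly (excess_poly j {1..N} q t) z) * indicator {0..} t \<partial>lborel)"
proof -
  define F where "F i = (\<Prod>k\<in>{1..N}. egf (arrival_weight j z i k) (q k))" for i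
  define G where "G i t = exp (- (q i * t)) * poly (\<Prod>l\<in>{1..N} - {i}. seen_poly j (q l * t)) z" for i t
  have q: "0 \<le> q k" if "k \<in> {1..N}" for k using that q_pos less_imp_le by blast
  have w: "0 \<le> arrival_weight j z i k c" for i k c
    using assms by (simp add: arrival_weight_def seen_weight_def)
  have F_nn: "0 \<le> fps_nth (F i) n" for i n
    unfolding F_def using w q by (intro fps_nth_prod_nonneg) (auto simp: fps_nth_egf)
  have rad: "fps_conv_radius (egf (arrival_weight j z i k) (q k)) = \<infinity>" for i k
    by (simp add: arrival_weight_def egf_unseen fps_conv_radius_egf_seen_weight)
  have rad_F: "fps_conv_radius (F i) = \<infinity>" for i
    unfolding F_def using rad by (intro fps_conv_radius_prod)
  have eval_F: "exp (- t) * eval_fps (F i) t = G i t" if i: "i \<in> {1..N}" for i t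
  proof -
    have "exp (- t) = exp (- (q i * t)) * (\<Prod>k\<in>{1..N} - {i}. exp (- (q k * t)))"
    proof -
      have "- t = (\<Sum>k\<in>{1..N}. - (q k * t))"
        using q_sum by (simp add: sum_negf flip: sum_distrib_right)
      then have "exp (- t) = (\<Prod>k\<in>{1..N}. exp (- (q k * t)))"
        by (simp add: exp_sum)
      then show ?thesis using i by (simp add: prod.remove)
    qed
    moreover have "eval_fps (F i) t = (\<Prod>k\<in>{1..N}. eval_fps (egf (arrival_weight j z i k) (q k)) t)"
      unfolding F_def using rad by (intro eval_fps_prod)
    then have "eval_fps (F i) t = (\<Prod>k\<in>{1..N} - {i}. eval_fps (egf (seen_weight j z) (q k)) t)"
      using i by (simp add: prod.remove arrival_weight_def egf_unseen)
    ultimately show ?thesis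
      unfolding G_def
      by (simp add: poly_prod eval_egf_seen_weight[symmetric] prod.distrib)
  qed
  have G_nn: "0 \<le> G i t" if "0 \<le> t" for i t
  proof -
    have "0 \<le> poly (seen_poly j (q l * t)) z" if "l \<in> {1..N} - {i}" for l
    proof -
      have "0 \<le> q l * t" using q[of l] that \<open>0 \<le> t\<close> by simp
      then show ?thesis
        unfolding seen_poly_def using assms poisson_short_nonneg[of "q l * t" j] by simp
    qed
    then show ?thesis unfolding G_def poly_prod by (intro mult_nonneg_nonneg prod_nonneg) auto
  qed
  have G_meas [measurable]: "G i \<in> borel_measurable borel" for i
    unfolding G_def seen_poly_def poly_prod poisson_short_def by simp
  have "(\<Sum>n. \<Sum>i\<in>{1..N}. \<integral>\<^sup>+\<omega>. ennreal (of_bool (\<omega> n = i) *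
      (\<Prod>k\<in>{1..N}. arrival_weight j z i k (cnt n \<omega> k))) \<partial>P)
      = (\<Sum>n. \<Sum>i\<in>{1..N}. ennreal (q i) * ennreal (fact n * fps_nth (F i) n))"
    using q by (intro suminf_cong sum.cong refl)
      (subst nn_integral_words, auto simp: w F_def ennreal_mult')
  also have "\<dots> = (\<Sum>i\<in>{1..N}. \<Sum>n. ennreal (q i) * ennreal (fact n * fps_nth (F i) n))"
    by (rule suminf_sum) simp
  also have "\<dots> = (\<Sum>i\<in>{1..N}. ennreal (q i) * (\<integral>\<^sup>+t. ennreal (G i t) * indicator {0..} t \<partial>lborel))"
    by (intro sum.cong refl)
       (simp add: ennreal_suminf_cmult suminf_fact_fps_eq_nn_integral[OF F_nn rad_F] eval_F)
  also have "\<dots> = (\<integral>\<^sup>+t. (\<Sum>i\<in>{1..N}. ennreal (q i) * (ennreal (G i t) * indicator {0..} t)) \<partial>lborel)"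
    by (simp add: nn_integral_sum nn_integral_cmult)
  also have "\<dots> = (\<integral>\<^sup>+t. ennreal (poly (excess_poly j {1..N} q t) z) * indicator {0..} t \<partial>lborel)"
  proof (rule nn_integral_cong)
    fix t :: real
    show "(\<Sum>i\<in>{1..N}. ennreal (q i) * (ennreal (G i t) * indicator {0..} t))
        = ennreal (poly (excess_poly j {1..N} q t) z) * indicator {0..} t"
    proof (cases "0 \<le> t")
      case True
      have "(\<Sum>i\<in>{1..N}. ennreal (q i) * ennreal (G i t)) = (\<Sum>i\<in>{1..N}. ennreal (q i * G i t))"
        using q by (intro sum.cong) (auto simp: ennreal_mult')
      also have "\<dots> = ennreal (\<Sum>i\<in>{1..N}. q i * G i t)"
        using q G_nn[OF True] by (intro sum_ennreal) auto
      also have "(\<Sum>i\<in>{1..N}. q i * G i t) = poly (excess_poly j {1..N} q t) z"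
        unfolding excess_poly_def G_def by (simp add: poly_sum mult_ac)
      finally show ?thesis using True by simp
    qed simp
  qed
  finally show ?thesis .
qed

end

section \<open>Completion of the collection\<close>

definition complete_collection :: "nat \<Rightarrow> (nat \<Rightarrow> nat) \<Rightarrow> bool" where
  "complete_collection N \<omega> \<longleftrightarrow> (\<forall>i\<in>{1..N}. \<exists>s. \<omega> s = i)"

lemma completion_time_eqI:
  assumes "1 \<le> N" "\<omega> n \<in> {1..N}" "cnt n \<omega> (\<omega> n) = 0"
    and "\<And>k. k \<in> {1..N} - {\<omega> n} \<Longrightarrow> 0 < cnt n \<omega> k"
  shows "completion_time N \<omega> = Suc n"
  unfolding completion_time_def
proof (rule Least_equality)
  show "\<forall>i\<in>{1..N}. \<exists>s<Suc n. \<omega> s = i"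
    using assms(4) by (metis DiffI cnt_pos_iff less_Suc_eq singletonD)
next
  fix t assume "\<forall>i\<in>{1..N}. \<exists>s<t. \<omega> s = i"
  then obtain s where "s < t" "\<omega> s = \<omega> n" using assms(2) by blast
  moreover have "\<not> s < n" using assms(3) \<open>\<omega> s = \<omega> n\<close> by (metis cnt_pos_iff less_irrefl)
  ultimately show "Suc n \<le> t" by simp
qed

lemma completion_time_cases:
  assumes "1 \<le> N" "complete_collection N \<omega>"
  obtains n where "completion_time N \<omega> = Suc n" "\<omega> n \<in> {1..N}" "cnt n \<omega> (\<omega> n) = 0"
    "\<And>k. k \<in> {1..N} - {\<omega> n} \<Longrightarrow> 0 < cnt n \<omega> k"
proof -
  let ?seen = "\<lambda>t. \<forall>i\<in>{1..N}. \<exists>s<t. \<omega> s = i"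
  obtain s where s: "\<And>i. i \<in> {1..N} \<Longrightarrow> \<omega> (s i) = i"
    using assms(2) unfolding complete_collection_def by metis
  have "?seen (Suc (Max (s ` {1..N})))"
    using s by (metis Max_ge finite_atLeastAtMost finite_imageI imageI le_imp_less_Suc)
  then have least: "?seen (completion_time N \<omega>)"
    unfolding completion_time_def by (rule LeastI)
  then have "completion_time N \<omega> \<noteq> 0"
    using assms(1) by force
  then obtain n where n: "completion_time N \<omega> = Suc n"
    by (cases "completion_time N \<omega>") auto
  have "\<not> ?seen n"
    using not_less_Least[of n ?seen] n unfolding completion_time_def by simp
  then obtain i where i: "i \<in> {1..N}" "\<not> (\<exists>s<n. \<omega> s = i)" by blast
  moreover have "\<omega> n = i"
    using least n i by (metis less_Suc_eq)
  moreover have "0 < cnt n \<omega> k" if "k \<in> {1..N} - {\<omega> n}" for k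
    using least n that by (metis DiffE cnt_pos_iff insertCI less_Suc_eq)
  ultimately show ?thesis
    using that n cnt_pos_iff[of n \<omega> i] by auto
qed

text \<open>The completing coupon itself accounts for one empty space, because its type has count \<open>1 < j\<close>.\<close>

lemma empty_spaces_at_completion:
  assumes "2 \<le> j" "completion_time N \<omega> = Suc n" "\<omega> n \<in> {1..N}" "cnt n \<omega> (\<omega> n) = 0"
  shows "empty_spaces N j \<omega> = Suc (card {k \<in> {1..N} - {\<omega> n}. cnt n \<omega> k < j})"
proof -
  have "empty_spaces N j \<omega> = card {i \<in> {1..N}. cnt (Suc n) \<omega> i < j}"
    using assms by (simp add: empty_spaces_eq cnt_def)
  also have "{i \<in> {1..N}. cnt (Suc n) \<omega> i < j}
      = insert (\<omega> n) {k \<in> {1..N} - {\<omega> n}. cnt n \<omega> k < j}"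
    using assms by (auto simp: cnt_Suc)
  finally show ?thesis by simp
qed

context coupon_law
begin

lemma N_pos: "1 \<le> N"
  using q_sum by (cases N) auto

text \<open>For a given sequence of coupons at most one \<open>n\<close> contributes, namely the one for which coupon \<open>n\<close>
  completes the collection.\<close>

lemma suminf_arrival_weight:
  assumes j: "2 \<le> j" and \<omega>: "\<And>s. \<omega> s \<in> {1..N}"
  shows "(\<Sum>n. \<Sum>i\<in>{1..N}. ennreal (of_bool (\<omega> n = i) *
      (\<Prod>k\<in>{1..N}. arrival_weight j z i k (cnt n \<omega> k)))) =
    (if complete_collection N \<omega> then ennreal ((1 + z) ^ (empty_spaces N j \<omega> - 1)) else 0)"
proof -
  let ?p = "\<lambda>n. \<Prod>k\<in>{1..N}. arrival_weight j z (\<omega> n) k (cnt n \<omega> k)"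
  have inner: "(\<Sum>i\<in>{1..N}. ennreal (of_bool (\<omega> n = i) *
      (\<Prod>k\<in>{1..N}. arrival_weight j z i k (cnt n \<omega> k)))) = ennreal (?p n)" for n
  proof -
    have "(\<Sum>i\<in>{1..N}. ennreal (of_bool (\<omega> n = i) *
        (\<Prod>k\<in>{1..N}. arrival_weight j z i k (cnt n \<omega> k))))
        = (\<Sum>i\<in>{1..N}. if \<omega> n = i then ennreal (?p n) else 0)"
      by (rule sum.cong) auto
    then show ?thesis using \<omega>[of n] by simp
  qed
  have last: "completion_time N \<omega> = Suc n" "complete_collection N \<omega>" if nz: "?p n \<noteq> 0" for n
  proof -
    have "arrival_weight j z (\<omega> n) k (cnt n \<omega> k) \<noteq> 0" if "k \<in> {1..N}" for k
      using nz that by (metis finite_atLeastAtMost prod_zero)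
    then have 0: "cnt n \<omega> (\<omega> n) = 0" "\<And>k. k \<in> {1..N} - {\<omega> n} \<Longrightarrow> 0 < cnt n \<omega> k"
      using \<omega>[of n] by (force simp: arrival_weight_def seen_weight_def split: if_splits)+
    show "completion_time N \<omega> = Suc n"
      using N_pos \<omega> 0 by (intro completion_time_eqI) auto
    show "complete_collection N \<omega>"
      unfolding complete_collection_def using 0(2) by (metis DiffI cnt_pos_iff singletonD)
  qed
  show ?thesis
  proof (cases "complete_collection N \<omega>")
    case False
    then have zero: "?p n = 0" for n using last by blast
    show ?thesis unfolding inner zero using False by simp
  next
    case True
    obtain n where n: "completion_time N \<omega> = Suc n" "\<omega> n \<in> {1..N}" "cnt n \<omega> (\<omega> n) = 0"
      "\<And>k. k \<in> {1..N} - {\<omega> n} \<Longrightarrow> 0 < cnt n \<omega> k"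
      using completion_time_cases[OF N_pos True] by metis
    have zero: "?p m = 0" if "m \<notin> {n}" for m
      using last(1)[of m] n(1) that by auto
    have "(\<Sum>n. ennreal (?p n)) = (\<Sum>m\<in>{n}. ennreal (?p m))"
    proof (rule suminf_finite)
      show "ennreal (?p m) = 0" if "m \<notin> {n}" for m
        unfolding zero[OF that] by (rule ennreal_0)
    qed simp
    moreover have "?p n = (1 + z) ^ (empty_spaces N j \<omega> - 1)"
    proof -
      have "?p n = (\<Prod>k\<in>{1..N} - {\<omega> n}. if cnt n \<omega> k < j then 1 + z else 1)"
      proof -
        have "arrival_weight j z (\<omega> n) k (cnt n \<omega> k) = (if cnt n \<omega> k < j then 1 + z else 1)"
          if "k \<in> {1..N} - {\<omega> n}" for k
          using n(4)[OF that] that by (auto simp: arrival_weight_def seen_weight_def)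
        moreover have "arrival_weight j z (\<omega> n) (\<omega> n) (cnt n \<omega> (\<omega> n)) = 1"
          using n(3) by (simp add: arrival_weight_def)
        ultimately show ?thesis
          using n(2) by (simp add: prod.remove)
      qed
      also have "\<dots> = (\<Prod>k\<in>{k \<in> {1..N} - {\<omega> n}. cnt n \<omega> k < j}. 1 + z)"
        by (rule prod.inter_filter[symmetric]) simp
      finally show ?thesis
        using empty_spaces_at_completion[OF j n(1-3)] by simp
    qed
    ultimately show ?thesis unfolding inner using True by simp
  qed
qed

lemma measurable_completion_time [measurable]:
  "completion_time N \<in> P \<rightarrow>\<^sub>M count_space UNIV"
proof -
  have "Measurable.pred P (\<lambda>\<omega>. \<forall>i\<in>{1..N}. \<exists>s<t. \<omega> s = i)" for t
    by measurable
  then show ?thesis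
    unfolding completion_time_def by measurable
qed

lemma pred_complete_collection [measurable]: "Measurable.pred P (complete_collection N)"
  unfolding complete_collection_def by measurable

lemma empty_spaces_le: "empty_spaces N j \<omega> \<le> N"
  unfolding empty_spaces_def by (rule order.trans[OF card_mono[of "{1..N}"]]) auto

lemma measurable_empty_spaces:
  assumes "1 \<le> j"
  shows "empty_spaces N j \<in> P \<rightarrow>\<^sub>M count_space {0..N}"
proof -
  have "(\<lambda>\<omega>. cnt (completion_time N \<omega>) \<omega> i) \<in> P \<rightarrow>\<^sub>M count_space UNIV" for i
    by (rule measurable_compose_countable[where f = "\<lambda>n \<omega>. cnt n \<omega> i"]) measurable
  then have "(\<lambda>\<omega>. of_bool (cnt (completion_time N \<omega>) \<omega> i < j) :: nat) \<in> P \<rightarrow>\<^sub>M count_space UNIV" for i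
    by (rule measurable_compose) simp
  then have "(\<lambda>\<omega>. \<Sum>i\<in>{1..N}. of_bool (cnt (completion_time N \<omega>) \<omega> i < j) :: nat)
      \<in> P \<rightarrow>\<^sub>M count_space UNIV"
    by measurable
  also have "(\<lambda>\<omega>. \<Sum>i\<in>{1..N}. of_bool (cnt (completion_time N \<omega>) \<omega> i < j) :: nat) = empty_spaces N j"
    using assms by (simp add: fun_eq_iff empty_spaces_eq cnt_def Int_def)
  finally have "empty_spaces N j \<in> P \<rightarrow>\<^sub>M count_space UNIV" .
  then have "empty_spaces N j -` A \<inter> space P \<in> sets P" for A
    by (simp add: measurable_sets)
  then show ?thesis
    by (auto intro!: measurableI simp: empty_spaces_le)
qed

lemma nn_integral_empty_spaces_power:
  assumes j: "2 \<le> j" and z: "0 \<le> z"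
  shows "(\<integral>\<^sup>+\<omega>. (if complete_collection N \<omega> then ennreal ((1 + z) ^ (empty_spaces N j \<omega> - 1)) else 0) \<partial>P) =
    (\<integral>\<^sup>+t. ennreal (poly (excess_poly j {1..N} q t) z) * indicator {0..} t \<partial>lborel)"
proof -
  have "(\<integral>\<^sup>+\<omega>. (if complete_collection N \<omega> then ennreal ((1 + z) ^ (empty_spaces N j \<omega> - 1)) else 0) \<partial>P)
      = (\<integral>\<^sup>+\<omega>. (\<Sum>n. \<Sum>i\<in>{1..N}. ennreal (of_bool (\<omega> n = i) *
          (\<Prod>k\<in>{1..N}. arrival_weight j z i k (cnt n \<omega> k)))) \<partial>P)"
    using suminf_arrival_weight[OF j space_P, symmetric] by (intro nn_integral_cong)
  also have "\<dots> = (\<Sum>n. \<Sum>i\<in>{1..N}. \<integral>\<^sup>+\<omega>. ennreal (of_bool (\<omega> n = i) *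
      (\<Prod>k\<in>{1..N}. arrival_weight j z i k (cnt n \<omega> k))) \<partial>P)"
    by (simp add: nn_integral_suminf nn_integral_sum)
  finally show ?thesis
    by (simp only: suminf_words_eq_nn_integral[OF z])
qed

section \<open>Expectations as limits of time integrals\<close>

text \<open>At \<open>z = 0\<close> the polynomial \<open>K\<close> is the density of the completion time of the Poissonized collection,
  the derivative of \<open>\<Prod>i. 1 - exp(- q i t)\<close>.  Its integral \<open>1\<close> is the probability of completion.  The value
  \<open>2\<close> for \<open>j\<close> is arbitrary.\<close>

lemma AE_complete_collection: "AE \<omega> in P. complete_collection N \<omega>"
proof -
  interpret prob_space P by (rule prob_space_P)
  have q: "0 < q i" if "i \<in> {1..N}" for i using that by (rule q_pos)
  let ?F = "\<lambda>t. \<Prod>i\<in>{1..N}. 1 - exp (- (q i * t))"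
  let ?f = "\<lambda>t. poly (excess_poly 2 {1..N} q t) 0"
  have f: "?f t = (\<Sum>i\<in>{1..N}. q i * exp (- (q i * t)) * (\<Prod>l\<in>{1..N} - {i}. 1 - exp (- (q l * t))))" for t
    by (simp add: excess_poly_def seen_poly_def poly_sum poly_prod)
  have "emeasure P {\<omega> \<in> space P. complete_collection N \<omega>}
      = (\<integral>\<^sup>+\<omega>. indicator {\<omega> \<in> space P. complete_collection N \<omega>} \<omega> \<partial>P)"
    by (subst nn_integral_indicator) auto
  also have "\<dots> = (\<integral>\<^sup>+\<omega>. (if complete_collection N \<omega> then ennreal ((1 + 0) ^ (empty_spaces N 2 \<omega> - 1)) else 0) \<partial>P)"
    by (intro nn_integral_cong) (auto simp: indicator_def)
  also have "\<dots> = (\<integral>\<^sup>+t. ennreal (?f t) * indicator {0..} t \<partial>lborel)"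
    by (rule nn_integral_empty_spaces_power) auto
  also have "\<dots> = ennreal (1 - ?F 0)"
  proof (rule nn_integral_FTC_atLeast)
    show "?f \<in> borel_measurable borel"
      unfolding f by simp
    show "(?F has_real_derivative ?f t) (at t)" for t
      unfolding f by (rule has_field_derivative_prod) (auto intro!: derivative_eq_intros)
    show "0 \<le> ?f t" if "0 \<le> t" for t
    proof -
      have "0 \<le> q i" "0 \<le> q i * t" if "i \<in> {1..N}" for i
        using q[OF that] \<open>0 \<le> t\<close> by auto
      then show ?thesis
        unfolding f by (intro sum_nonneg mult_nonneg_nonneg prod_nonneg) auto
    qed
    have "((\<lambda>t. 1 - exp (- (q i * t))) \<longlongrightarrow> 1) at_top" if "i \<in> {1..N}" for i
      using q[OF that] by real_asymp
    then have "(?F \<longlongrightarrow> (\<Prod>i\<in>{1..N}. 1)) at_top"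
      by (intro tendsto_prod)
    then show "(?F \<longlongrightarrow> 1) at_top" by simp
  qed
  also have "?F 0 = 0"
    using N_pos by auto
  finally have "prob {\<omega> \<in> space P. complete_collection N \<omega>} = 1"
    by (simp add: measure_def)
  then show ?thesis
    by (subst (asm) prob_Collect_eq_1) simp_all
qed

lemma AE_empty_spaces_pos:
  assumes "2 \<le> j"
  shows "AE \<omega> in P. 1 \<le> empty_spaces N j \<omega>"
  using AE_complete_collection
proof eventually_elim
  case (elim \<omega>)
  obtain n where "completion_time N \<omega> = Suc n" "\<omega> n \<in> {1..N}" "cnt n \<omega> (\<omega> n) = 0"
    using completion_time_cases[OF N_pos elim] by metis
  then show ?case using empty_spaces_at_completion[OF assms] by simp
qed

lemma measurable_empty_spaces_UNIV:
  "1 \<le> j \<Longrightarrow> empty_spaces N j \<in> P \<rightarrow>\<^sub>M count_space UNIV"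
  using measurable_compose[OF measurable_empty_spaces, of j "\<lambda>x. x" "count_space UNIV"] by simp

lemma integrable_empty_spaces:
  fixes g :: "nat \<Rightarrow> real"
  assumes "1 \<le> j"
  shows "integrable P (\<lambda>\<omega>. g (empty_spaces N j \<omega>))"
proof -
  interpret prob_space P by (rule prob_space_P)
  have "\<bar>g (empty_spaces N j \<omega>)\<bar> \<le> (\<Sum>k\<le>N. \<bar>g k\<bar>)" for \<omega>
    using empty_spaces_le[of j \<omega>] by (intro member_le_sum[where f = "\<lambda>k. \<bar>g k\<bar>"]) auto
  moreover have "(\<lambda>\<omega>. g (empty_spaces N j \<omega>)) \<in> borel_measurable P"
    by (rule measurable_compose[OF measurable_empty_spaces_UNIV[OF assms]]) simp
  ultimately show ?thesis
    by (intro integrable_const_bound[where B = "\<Sum>k\<le>N. \<bar>g k\<bar>"]) auto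
qed

text \<open>The generating function of \<open>U - 1\<close> and the integral of \<open>K\<close> agree for all \<open>z \<ge> 0\<close>, both are
  polynomials of degree at most \<open>N\<close>, and so their coefficients agree.  Nonnegativity of the coefficients of
  \<open>K\<close> makes all interchanges of sums and integrals harmless.\<close>

lemma integral_coeff_excess_poly_tendsto:
  assumes j: "2 \<le> j" and m: "m \<le> N"
  shows "((\<lambda>T. integral {0..T} (\<lambda>t. coeff (excess_poly j {1..N} q t) m)) \<longlongrightarrow>
    (\<integral>\<omega>. real ((empty_spaces N j \<omega> - 1) choose m) \<partial>P)) at_top"
proof -
  interpret prob_space P by (rule prob_space_P)
  let ?V = "\<lambda>\<omega>. empty_spaces N j \<omega> - 1"
  let ?c = "\<lambda>m t. coeff (excess_poly j {1..N} q t) m"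
  have q: "0 \<le> q i" if "i \<in> {1..N}" for i using q_pos[OF that] by simp
  have "coeff_continuous_on UNIV (\<lambda>t. excess_poly j {1..N} q t)"
    by (rule coeff_continuous_on_excess_poly) (auto intro: continuous_intros)
  then have cont: "continuous_on UNIV (?c m)" for m
    by (simp add: coeff_continuous_on_def)
  then have [measurable]: "?c m \<in> borel_measurable borel" for m
    by (rule borel_measurable_continuous_onI)
  have nn: "0 \<le> ?c m t" if "0 \<le> t" for m t
    using q that by (intro coeff_excess_poly_nonneg) auto
  define \<kappa> where "\<kappa> m = (\<integral>\<^sup>+t. ennreal (?c m t) * indicator {0..} t \<partial>lborel)" for m
  have power: "ennreal (\<integral>\<omega>. (1 + z) ^ ?V \<omega> \<partial>P) = (\<Sum>m\<le>N. ennreal (z ^ m) * \<kappa> m)" if z: "0 \<le> z" for z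
  proof -
    have "ennreal (\<integral>\<omega>. (1 + z) ^ ?V \<omega> \<partial>P) = (\<integral>\<^sup>+\<omega>. ennreal ((1 + z) ^ ?V \<omega>) \<partial>P)"
      using integrable_empty_spaces[of j "\<lambda>k. (1 + z) ^ (k - 1)"] j z
      by (intro nn_integral_eq_integral[symmetric]) auto
    also have "\<dots> = (\<integral>\<^sup>+\<omega>. (if complete_collection N \<omega> then ennreal ((1 + z) ^ ?V \<omega>) else 0) \<partial>P)"
      using AE_complete_collection by (intro nn_integral_cong_AE) (auto elim!: eventually_mono)
    also have "\<dots> = (\<integral>\<^sup>+t. ennreal (poly (excess_poly j {1..N} q t) z) * indicator {0..} t \<partial>lborel)"
      by (rule nn_integral_empty_spaces_power[OF j z])
    also have "\<dots> = (\<integral>\<^sup>+t. (\<Sum>m\<le>N. ennreal (z ^ m) * (ennreal (?c m t) * indicator {0..} t)) \<partial>lborel)"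
    proof (rule nn_integral_cong)
      fix t :: real
      show "ennreal (poly (excess_poly j {1..N} q t) z) * indicator {0..} t
          = (\<Sum>m\<le>N. ennreal (z ^ m) * (ennreal (?c m t) * indicator {0..} t))"
      proof (cases "0 \<le> t")
        case True
        have "poly (excess_poly j {1..N} q t) z = (\<Sum>m\<le>N. ?c m t * z ^ m)"
          using degree_excess_poly_le[of "{1..N}" j q t] by (intro poly_eq_sum_coeff) simp
        then have "ennreal (poly (excess_poly j {1..N} q t) z) = (\<Sum>m\<le>N. ennreal (?c m t * z ^ m))"
          using nn[OF True] z by (simp add: sum_ennreal)
        also have "\<dots> = (\<Sum>m\<le>N. ennreal (z ^ m) * ennreal (?c m t))"
          using nn[OF True] z by (intro sum.cong) (auto simp: ennreal_mult mult.commute)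
        finally show ?thesis using True by simp
      qed simp
    qed
    also have "\<dots> = (\<Sum>m\<le>N. ennreal (z ^ m) * \<kappa> m)"
      unfolding \<kappa>_def
      by (subst nn_integral_sum, measurable) (intro sum.cong refl nn_integral_cmult, measurable)
    finally show ?thesis .
  qed
  have finite: "\<kappa> m < \<infinity>" if "m \<le> N" for m
  proof -
    have "\<kappa> m \<le> (\<Sum>m\<le>N. ennreal (1 ^ m) * \<kappa> m)"
      using that member_le_sum[of m "{..N}" \<kappa>] by simp
    also have "\<dots> < \<infinity>"
      using power[of 1] by (metis ennreal_less_top infinity_ennreal_def zero_le_one)
    finally show ?thesis .
  qed
  have "(\<integral>\<omega>. real (?V \<omega> choose m) \<partial>P) = enn2real (\<kappa> m)"
  proof (rule coeffs_eqI_nonneg[OF _ m])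
    fix z :: real assume z: "0 \<le> z"
    have int: "integrable P (\<lambda>\<omega>. real (?V \<omega> choose m) * z ^ m)" for m
      using integrable_empty_spaces[of j "\<lambda>k. real ((k - 1) choose m) * z ^ m"] j by simp
    have binomial: "(\<Sum>m\<le>N. real (?V \<omega> choose m) * z ^ m) = (1 + z) ^ ?V \<omega>" for \<omega>
    proof -
      have "(1 + z) ^ ?V \<omega> = (\<Sum>m\<le>?V \<omega>. real (?V \<omega> choose m) * z ^ m)"
        using binomial_ring[of z 1 "?V \<omega>"] by (simp add: add.commute)
      also have "\<dots> = (\<Sum>m\<le>N. real (?V \<omega> choose m) * z ^ m)"
        using empty_spaces_le[of j \<omega>] by (intro sum.mono_neutral_left) auto
      finally show ?thesis by simp
    qed
    have "(\<Sum>m\<le>N. (\<integral>\<omega>. real (?V \<omega> choose m) \<partial>P) * z ^ m)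
        = (\<integral>\<omega>. (\<Sum>m\<le>N. real (?V \<omega> choose m) * z ^ m) \<partial>P)"
      using int by (simp add: Bochner_Integration.integral_sum)
    also have "\<dots> = (\<integral>\<omega>. (1 + z) ^ ?V \<omega> \<partial>P)"
      by (simp only: binomial)
    also have "\<dots> = enn2real (\<Sum>m\<le>N. ennreal (z ^ m) * \<kappa> m)"
      unfolding power[OF z, symmetric] using z by (simp add: integral_nonneg)
    also have "\<dots> = (\<Sum>m\<le>N. enn2real (ennreal (z ^ m) * \<kappa> m))"
      using finite enn2real_sum[of "{..N}" "\<lambda>m. ennreal (z ^ m) * \<kappa> m"]
      by (simp add: ennreal_mult_less_top comp_def)
    also have "\<dots> = (\<Sum>m\<le>N. enn2real (\<kappa> m) * z ^ m)"
      using z by (intro sum.cong) (auto simp: enn2real_mult mult.commute)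
    finally show "(\<Sum>m\<le>N. (\<integral>\<omega>. real (?V \<omega> choose m) \<partial>P) * z ^ m) = (\<Sum>m\<le>N. enn2real (\<kappa> m) * z ^ m)" .
  qed
  moreover have "((\<lambda>T. integral {0..T} (?c m)) \<longlongrightarrow> enn2real (\<kappa> m)) at_top"
  proof -
    let ?f = "\<lambda>t. ?c m t * indicator {0..} t"
    have f_nn: "0 \<le> ?f t" for t using nn[of t m] by (auto simp: indicator_def)
    have f_nn_int: "(\<integral>\<^sup>+t. ennreal (?f t) \<partial>lborel) = \<kappa> m"
      unfolding \<kappa>_def by (intro nn_integral_cong) (auto simp: indicator_def)
    have f_int: "integrable lborel ?f"
    proof (rule integrableI_nonneg)
      show "?f \<in> borel_measurable lborel" by measurable
    qed (use f_nn f_nn_int finite[OF m] in auto)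
    have "((\<lambda>T. \<integral>t. indicator {..T} t *\<^sub>R ?f t \<partial>lborel) \<longlongrightarrow> (\<integral>t. ?f t \<partial>lborel)) at_top"
      by (rule tendsto_integral_at_top[OF _ f_int]) simp
    moreover have "(\<integral>t. ?f t \<partial>lborel) = enn2real (\<kappa> m)"
      unfolding f_nn_int[symmetric] using f_nn f_int by (intro integral_eq_nn_integral) auto
    moreover have "(\<integral>t. indicator {..T} t *\<^sub>R ?f t \<partial>lborel) = integral {0..T} (?c m)" for T
    proof -
      have "set_integrable lborel {0..T} (?c m)"
        by (rule borel_integrable_atLeastAtMost') (rule continuous_on_subset[OF cont subset_UNIV])
      then have "(LINT t:{0..T}|lborel. ?c m t) = integral {0..T} (?c m)"
        by (rule set_borel_integral_eq_integral)
      moreover have "(\<integral>t. indicator {..T} t *\<^sub>R ?f t \<partial>lborel) = (LINT t:{0..T}|lborel. ?c m t)"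
        unfolding set_lebesgue_integral_def
        by (rule Bochner_Integration.integral_cong) (auto simp: indicator_def)
      ultimately show ?thesis by simp
    qed
    ultimately show ?thesis by simp
  qed
  ultimately show ?thesis by simp
qed

text \<open>Pascal's rule, applicable because \<open>U \<ge> 1\<close> almost surely.\<close>

lemma expected_choose_split:
  assumes "2 \<le> j" "1 \<le> m"
  shows "(\<integral>\<omega>. real (empty_spaces N j \<omega> choose m) \<partial>P) =
    (\<integral>\<omega>. real ((empty_spaces N j \<omega> - 1) choose m) \<partial>P) +
    (\<integral>\<omega>. real ((empty_spaces N j \<omega> - 1) choose (m - 1)) \<partial>P)"
proof -
  have int: "integrable P (\<lambda>\<omega>. real ((empty_spaces N j \<omega> - 1) choose m))" for m
    using integrable_empty_spaces[of j "\<lambda>k. real ((k - 1) choose m)"] assms by simp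
  have "(\<integral>\<omega>. real (empty_spaces N j \<omega> choose m) \<partial>P) = (\<integral>\<omega>. real ((empty_spaces N j \<omega> - 1) choose m)
      + real ((empty_spaces N j \<omega> - 1) choose (m - 1)) \<partial>P)"
  proof (rule integral_cong_AE)
    show "AE \<omega> in P. real (empty_spaces N j \<omega> choose m) = real ((empty_spaces N j \<omega> - 1) choose m)
        + real ((empty_spaces N j \<omega> - 1) choose (m - 1))"
      using AE_empty_spaces_pos[OF assms(1)]
    proof eventually_elim
      case (elim \<omega>)
      then obtain v k where "empty_spaces N j \<omega> = Suc v" "m = Suc k"
        using assms(2) by (metis Suc_le_D One_nat_def)
      then show ?case by simp
    qed
    show "(\<lambda>\<omega>. real (empty_spaces N j \<omega> choose m)) \<in> borel_measurable P"
      using integrable_empty_spaces[of j "\<lambda>k. real (k choose m)"] assms by auto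
  qed (use int in \<open>auto intro!: borel_measurable_add\<close>)
  then show ?thesis using int by simp
qed

lemma expected_abm_expansion:
  assumes "1 \<le> j" "abm_expansion N a f"
  shows "(\<integral>\<omega>. f (empty_spaces N j \<omega>) \<partial>P) =
    a 0 + (\<Sum>m=1..N. a m * (\<integral>\<omega>. real (empty_spaces N j \<omega> choose m) \<partial>P))"
proof -
  interpret prob_space P by (rule prob_space_P)
  have int: "integrable P (\<lambda>\<omega>. real (empty_spaces N j \<omega> choose m))" for m
    using integrable_empty_spaces[of j "\<lambda>k. real (k choose m)"] assms by simp
  have "f (empty_spaces N j \<omega>) = (\<Sum>m=0..N. a m * real (empty_spaces N j \<omega> choose m))" for \<omega>
    using assms(2) empty_spaces_le[of j \<omega>] unfolding abm_expansion_def by auto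
  then have "(\<integral>\<omega>. f (empty_spaces N j \<omega>) \<partial>P)
      = (\<Sum>m=0..N. a m * (\<integral>\<omega>. real (empty_spaces N j \<omega> choose m) \<partial>P))"
    using int by (simp add: Bochner_Integration.integral_sum)
  then show ?thesis
    by (simp add: sum.atLeast_Suc_atMost prob_space)
qed

end

section \<open>The absolutely monotone comparison\<close>

theorem corollary5p5:
  fixes N j :: nat and p :: "nat \<Rightarrow> real" and \<theta>1 \<theta>2 :: real
  assumes "2 \<le> N" and "2 \<le> j"
    and "\<forall>i\<in>{1..N}. 0 < p i" and "(\<Sum>i=1..N. p i) = 1"
    and "\<exists>i\<in>{1..N}. p i \<noteq> uniform_law N i"
    and "0 \<le> \<theta>1" and "\<theta>1 < \<theta>2" and "\<theta>2 \<le> 1"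
  shows "abm_le N (coupon_space N (segment_law N p \<theta>2)) (empty_spaces N j)
                  (coupon_space N (segment_law N p \<theta>1)) (empty_spaces N j)
    \<and> (\<forall>f a. abm_expansion N a f \<longrightarrow>
        (\<integral>\<omega>. f (empty_spaces N j \<omega>) \<partial>coupon_space N (segment_law N p \<theta>2))
          \<le> (\<integral>\<omega>. f (empty_spaces N j \<omega>) \<partial>coupon_space N (segment_law N p \<theta>1)))
    \<and> (\<forall>f a. abm_expansion N a f \<and> (\<exists>m\<in>{1..N}. 0 < a m) \<longrightarrow>
        (\<integral>\<omega>. f (empty_spaces N j \<omega>) \<partial>coupon_space N (segment_law N p \<theta>2))
          < (\<integral>\<omega>. f (empty_spaces N j \<omega>) \<partial>coupon_space N (segment_law N p \<theta>1)))"
proof -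
  define d where "d i = p i - uniform_law N i" for i
  have sum_d: "(\<Sum>i\<in>{1..N}. d i) = 0"
    using assms(1,4) by (simp add: d_def uniform_law_def sum_subtractf)
  interpret seg: coupon_segment "{1..N}" j "1 / real N" d
  proof
    show "0 < 1 / real N + d i" if "i \<in> {1..N}" for i
      using assms(3) that by (simp add: d_def uniform_law_def)
  qed (use assms(1,2) in auto)
  have q_eq: "seg.q \<theta> = segment_law N p \<theta>" for \<theta>
    by (simp add: fun_eq_iff seg.q_def segment_law_def d_def uniform_law_def)
  have law: "coupon_law N (segment_law N p \<theta>)" if "0 \<le> \<theta>" "\<theta> \<le> 1" for \<theta>
  proof
    show "0 < segment_law N p \<theta> i" if "i \<in> {1..N}" for i
      using seg.q_pos[OF that \<open>0 \<le> \<theta>\<close> \<open>\<theta> \<le> 1\<close>] by (simp add: q_eq)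
    have "(\<Sum>i\<in>{1..N}. seg.q \<theta> i) = 1"
      using assms(1) sum_d by (simp add: seg.q_def sum.distrib flip: sum_distrib_left)
    then show "(\<Sum>i\<in>{1..N}. segment_law N p \<theta> i) = 1"
      by (simp add: q_eq)
  qed
  obtain a b where ab: "a \<in> {1..N}" "b \<in> {1..N}" "d a \<noteq> d b"
  proof -
    obtain a where a: "a \<in> {1..N}" "d a \<noteq> 0"
      using assms(5) by (auto simp: d_def)
    have "\<exists>b\<in>{1..N}. d a \<noteq> d b"
    proof (rule ccontr)
      assume "\<not> ?thesis"
      then have "(\<Sum>i\<in>{1..N}. d i) = (\<Sum>i\<in>{1..N}. d a)"
        by (intro sum.cong) auto
      then show False using sum_d a assms(1) by simp
    qed
    then show ?thesis using that a by blast
  qed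

  define k where "k \<theta> m = (\<integral>\<omega>. real ((empty_spaces N j \<omega> - 1) choose m) \<partial>coupon_space N (segment_law N p \<theta>))" for \<theta> m
  define c where "c \<theta> m = (\<integral>\<omega>. real (empty_spaces N j \<omega> choose m) \<partial>coupon_space N (segment_law N p \<theta>))" for \<theta> m
  have lim: "((\<lambda>T. integral {0..T} (\<lambda>t. coeff (seg.K \<theta> t) m)) \<longlongrightarrow> k \<theta> m) at_top"
    if "0 \<le> \<theta>" "\<theta> \<le> 1" "m \<le> N" for \<theta> m
    unfolding k_def seg.K_def q_eq
    using law[OF that(1,2)] assms(2) that(3) by (rule coupon_law.integral_coeff_excess_poly_tendsto)
  have k_mono: "k \<theta>' m \<le> k \<theta> m" if "0 \<le> \<theta>" "\<theta> < \<theta>'" "\<theta>' \<le> 1" "m \<le> N" for \<theta> \<theta>' m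
    using that by (intro seg.limit_mono[OF _ _ _ lim lim]) auto
  \<comment> \<open>The decrease is strict only away from \<open>\<theta> = 0\<close>, so the midpoint is inserted to cover \<open>\<theta>1 = 0\<close>.\<close>
  have k_strict: "k \<theta>2 m < k \<theta>1 m" if "1 \<le> m" "m < N" for m
  proof -
    define \<theta> where "\<theta> = (\<theta>1 + \<theta>2) / 2"
    have \<theta>: "0 < \<theta>" "\<theta>1 < \<theta>" "\<theta> < \<theta>2" using assms(6,7) by (auto simp: \<theta>_def)
    have "k \<theta>2 m < k \<theta> m"
      using \<theta> assms(8) that ab by (intro seg.limit_strict_mono[OF _ _ _ lim lim]) auto
    also have "\<dots> \<le> k \<theta>1 m"
      using \<theta> assms(6,8) that by (intro k_mono) auto
    finally show ?thesis .
  qed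
  have split: "c \<theta> m = k \<theta> m + k \<theta> (m - 1)" if "0 \<le> \<theta>" "\<theta> \<le> 1" "1 \<le> m" for \<theta> m
    unfolding c_def k_def
    using law[OF that(1,2)] assms(2) that(3) by (rule coupon_law.expected_choose_split)
  \<comment> \<open>For \<open>m < N\<close> the summand \<open>k m\<close> decreases strictly; for \<open>m = N\<close> the summand \<open>k (N - 1)\<close> does, as \<open>N \<ge> 2\<close>.\<close>
  have c_strict: "c \<theta>2 m < c \<theta>1 m" if "m \<in> {1..N}" for m
  proof (cases "m < N")
    case True
    have "k \<theta>2 m < k \<theta>1 m" "k \<theta>2 (m - 1) \<le> k \<theta>1 (m - 1)"
      using True that assms(6-8) by (auto intro: k_strict k_mono)
    then show ?thesis using split that assms(6-8) by simp
  next
    case False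
    then have "k \<theta>2 m \<le> k \<theta>1 m" "k \<theta>2 (m - 1) < k \<theta>1 (m - 1)"
      using that assms(1,6-8) by (auto intro: k_strict k_mono)
    then show ?thesis using split that assms(6-8) by simp
  qed
  have expect: "(\<integral>\<omega>. f (empty_spaces N j \<omega>) \<partial>coupon_space N (segment_law N p \<theta>))
      = a 0 + (\<Sum>m=1..N. a m * c \<theta> m)"
    if "0 \<le> \<theta>" "\<theta> \<le> 1" "abm_expansion N a f" for \<theta> a f
    unfolding c_def using law[OF that(1,2)] _ that(3)
    by (rule coupon_law.expected_abm_expansion) (use assms(2) in simp)
  have weak: "(\<integral>\<omega>. f (empty_spaces N j \<omega>) \<partial>coupon_space N (segment_law N p \<theta>2))
      \<le> (\<integral>\<omega>. f (empty_spaces N j \<omega>) \<partial>coupon_space N (segment_law N p \<theta>1))"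
    if "abm_expansion N a f" for f a
  proof -
    have "(\<Sum>m=1..N. a m * c \<theta>2 m) \<le> (\<Sum>m=1..N. a m * c \<theta>1 m)"
      using that less_imp_le[OF c_strict] unfolding abm_expansion_def
      by (intro sum_mono mult_left_mono) auto
    then show ?thesis using that assms(6-8) by (simp add: expect)
  qed
  moreover have "(\<integral>\<omega>. f (empty_spaces N j \<omega>) \<partial>coupon_space N (segment_law N p \<theta>2))
      < (\<integral>\<omega>. f (empty_spaces N j \<omega>) \<partial>coupon_space N (segment_law N p \<theta>1))"
    if f: "abm_expansion N a f" and m: "m \<in> {1..N}" "0 < a m" for f a m
  proof -
    have "(\<Sum>m=1..N. a m * c \<theta>2 m) < (\<Sum>m=1..N. a m * c \<theta>1 m)"
    proof (rule sum_strict_mono_ex1)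
      show "\<forall>m\<in>{1..N}. a m * c \<theta>2 m \<le> a m * c \<theta>1 m"
        using f less_imp_le[OF c_strict] unfolding abm_expansion_def
        by (intro ballI mult_left_mono) auto
      show "\<exists>m\<in>{1..N}. a m * c \<theta>2 m < a m * c \<theta>1 m"
        using m c_strict by (auto intro!: bexI[of _ m] mult_strict_left_mono)
    qed simp
    then show ?thesis using f assms(6-8) by (simp add: expect)
  qed
  moreover have "abm_le N (coupon_space N (segment_law N p \<theta>2)) (empty_spaces N j)
      (coupon_space N (segment_law N p \<theta>1)) (empty_spaces N j)"
    unfolding abm_le_def
    using weak assms(2,6-8) law
    by (auto intro!: coupon_law.prob_space_P coupon_law.measurable_empty_spaces)
  ultimately show ?thesis by blast
qed

end
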